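(* Let $b(t)=\sum_{n=-r}^{s} b_n t^n$ be a Laurent polynomial with $r,s$ positive integers and $b_{-r}\neq 0$, $b_s\neq 0$. Then there exist $\rho_l,\rho_h$ with $0<\rho_l\le \rho_h<\infty$ such that $$\Lambda(b)=\bigcap_{\rho\in(0,\infty)}\operatorname{sp} T(b_\rho)=\bigcap_{\rho\in[\rho_l,\rho_h]}\operatorname{sp} T(b_\rho).$$ Furthermore, examples of such $\rho_l$ and $\rho_h$ can be found by solving a polynomial equation with real coefficients.
   Context: $\mathbb{T}$ is the unit circle in $\mathbb{C}$. For a continuous function (symbol) $a:\mathbb{T}\to\mathbb{C}$ with Fourier coefficients $(a_k)_{k\in\mathbb{Z}}$, $T(a)=(a_{j-k})_{j,k=0}^{\infty}$ is the Toeplitz operator on $\ell^2(\mathbb{N})$, a bounded operator, and $\operatorname{sp} T(a)$ is its spectrum. It is known (Gohberg) that $\operatorname{sp} T(a)=a(\mathbb{T})\cup\{\lambda\in\mathbb{C}\setminus a(\mathbb{T}):\operatorname{wind}(a-\lambda)\ne 0\}$, where $\operatorname{wind}(a-\lambda)$ is the winding number of the closed curve $v\mapsto a(e^{iv})$, $v\in[0,2\pi]$, around $\lambda$. For $\rho>0$, $b_\rho$ denotes the symbol $b_\rho(t):=b(\rho t)$, $t\in\mathbb{T}$. The limit set $\Lambda(b)$ is defined as follows. For $\lambda\in\mathbb{C}$ let $z_1(\lambda),\dots,z_{r+s}(\lambda)$ be the zeros, with multiplicity, of the polynomial $z\mapsto z^r(b(z)-\lambda)$, ordered so that $|z_j(\lambda)|\le|z_{j+1}(\lambda)|$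 for $1\le j\le r+s-1$. Then $\Lambda(b):=\{\lambda\in\mathbb{C}: |z_r(\lambda)|=|z_{r+1}(\lambda)|\}$. It is a known theorem of Schmidt and Spitzer that $\Lambda(b)=\bigcap_{\rho\in(0,\infty)}\operatorname{sp} T(b_\rho)$. *)

theory Defs
  imports "HOL-Analysis.Analysis" "HOL-Computational_Algebra.Computational_Algebra"
begin

definition ell2 :: "(nat \<Rightarrow> complex) set" where
  "ell2 = {x. summable (\<lambda>n. (cmod (x n))\<^sup>2)}"

definition ell2_norm :: "(nat \<Rightarrow> complex) \<Rightarrow> real" where
  "ell2_norm x = sqrt (\<Sum>n. (cmod (x n))\<^sup>2)"

definition bounded_op_ell2 :: "((nat \<Rightarrow> complex) \<Rightarrow> (nat \<Rightarrow> complex)) \<Rightarrow> bool" where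
  "bounded_op_ell2 A \<longleftrightarrow>
     (\<forall>x\<in>ell2. A x \<in> ell2) \<and>
     (\<forall>x\<in>ell2. \<forall>y\<in>ell2. A (\<lambda>n. x n + y n) = (\<lambda>n. A x n + A y n)) \<and>
     (\<forall>c. \<forall>x\<in>ell2. A (\<lambda>n. c * x n) = (\<lambda>n. c * A x n)) \<and>
     (\<exists>K. \<forall>x\<in>ell2. ell2_norm (A x) \<le> K * ell2_norm x)"

text \<open>Operators are total functions on sequences of which only the restriction to
  \<^const>\<open>ell2\<close> matters. The spectrum is meant for operators that are bounded on
  \<^const>\<open>ell2\<close>.\<close>

definition spectrum_ell2 :: "((nat \<Rightarrow> complex) \<Rightarrow> (nat \<Rightarrow> complex)) \<Rightarrow> complex set" where
  "spectrum_ell2 A = {z. \<not> (\<exists>B. bounded_op_ell2 B \<and>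
     (\<forall>x\<in>ell2. B (\<lambda>n. A x n - z * x n) = x) \<and>
     (\<forall>x\<in>ell2. (\<lambda>n. A (B x) n - z * B x n) = x))}"

definition fourier_coeff :: "(complex \<Rightarrow> complex) \<Rightarrow> int \<Rightarrow> complex" where
  "fourier_coeff a k =
     integral {0..2 * pi} (\<lambda>v. a (cis v) * cis (- (of_int k * v))) / of_real (2 * pi)"

definition toeplitz :: "(complex \<Rightarrow> complex) \<Rightarrow> (nat \<Rightarrow> complex) \<Rightarrow> (nat \<Rightarrow> complex)" where
  "toeplitz a x = (\<lambda>j. \<Sum>k. fourier_coeff a (int j - int k) * x k)"

definition dilate :: "(complex \<Rightarrow> complex) \<Rightarrow> real \<Rightarrow> complex \<Rightarrow> complex" where
  "dilate a \<rho> = (\<lambda>t. a (of_real \<rho> * t))"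

text \<open>A Laurent polynomial is given by its coefficients \<open>b\<close>, of which only those with index
  between \<open>- r\<close> and \<open>s\<close> are used.\<close>

definition laurent :: "(int \<Rightarrow> complex) \<Rightarrow> nat \<Rightarrow> nat \<Rightarrow> complex \<Rightarrow> complex" where
  "laurent b r s t = (\<Sum>n = - int r..int s. b n * t powi n)"

definition char_poly_laurent :: "(int \<Rightarrow> complex) \<Rightarrow> nat \<Rightarrow> nat \<Rightarrow> complex \<Rightarrow> complex poly" where
  "char_poly_laurent b r s z =
     (\<Sum>n = - int r..int s. monom (b n) (nat (n + int r))) - monom z r"

lemma poly_char_poly_laurent:
  assumes "t \<noteq> 0"
  shows "poly (char_poly_laurent b r s z) t = t ^ r * (laurent b r s t - z)"
proof -
  have "b n * t ^ nat (n + int r) = t ^ r * (b n * t powi n)"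
    if "n \<in> {- int r..int s}" for n
  proof -
    have "t ^ nat (n + int r) = t powi (n + int r)"
      using that by (simp add: power_int_def)
    also have "\<dots> = t powi n * t ^ r"
      using assms by (simp add: power_int_add)
    finally show ?thesis by simp
  qed
  then have "(\<Sum>n = - int r..int s. b n * t ^ nat (n + int r)) =
      (\<Sum>n = - int r..int s. t ^ r * (b n * t powi n))"
    by (rule sum.cong[OF refl])
  then show ?thesis
    by (simp add: char_poly_laurent_def laurent_def poly_sum poly_monom sum_distrib_left
        right_diff_distrib mult.commute[of z])
qed

text \<open>The list \<open>zs\<close> enumerates the zeros from index \<open>0\<close>, so the \<open>r\<close>-th and the \<open>(r + 1)\<close>-st
  zero are \<open>zs ! (r - 1)\<close> and \<open>zs ! r\<close>. Zeros of equal modulus may be listed in any order,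
  which does not affect the moduli at given positions.\<close>

definition limit_set :: "(int \<Rightarrow> complex) \<Rightarrow> nat \<Rightarrow> nat \<Rightarrow> complex set" where
  "limit_set b r s = {z. \<exists>zs. mset zs = proots (char_poly_laurent b r s z) \<and>
     sorted (map cmod zs) \<and> cmod (zs ! (r - 1)) = cmod (zs ! r)}"

text \<open>A positive \<open>\<rho>\<close> is a root of the polynomials below if and only if
  \<open>\<bar>b\<^sub>s\<bar> \<rho>\<^sup>s - \<Sum>\<^bsub>n<s\<^esub> \<bar>b\<^sub>n\<bar> \<rho>\<^sup>n = \<Sum>\<^sub>n \<bar>b\<^sub>n\<bar>\<close> and
  \<open>\<bar>b\<^bsub>-r\<^esub>\<bar> \<rho>\<^bsup>-r\<^esup> - \<Sum>\<^bsub>n>-r\<^esub> \<bar>b\<^sub>n\<bar> \<rho>\<^sup>n = \<Sum>\<^sub>n \<bar>b\<^sub>n\<bar>\<close>, respectively.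
  The left-hand sides are lower bounds for the modulus of the Laurent polynomial on the
  circle of radius \<open>\<rho>\<close>; the right-hand side is an upper bound for it on the unit circle.\<close>

definition coeff_bound :: "(int \<Rightarrow> complex) \<Rightarrow> nat \<Rightarrow> nat \<Rightarrow> real" where
  "coeff_bound b r s = (\<Sum>n = - int r..int s. cmod (b n))"

definition upper_radius_poly :: "(int \<Rightarrow> complex) \<Rightarrow> nat \<Rightarrow> nat \<Rightarrow> real poly" where
  "upper_radius_poly b r s =
     monom (cmod (b (int s))) (r + s)
     - (\<Sum>n\<in>{- int r..<int s}. monom (cmod (b n)) (nat (n + int r)))
     - monom (coeff_bound b r s) r"

definition lower_radius_poly :: "(int \<Rightarrow> complex) \<Rightarrow> nat \<Rightarrow> nat \<Rightarrow> real poly" where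
  "lower_radius_poly b r s =
     monom (cmod (b (- int r))) 0
     - (\<Sum>n\<in>{- int r<..int s}. monom (cmod (b n)) (nat (n + int r)))
     - monom (coeff_bound b r s) r"

end

theory Submission
  imports Defs
begin

text \<open>
  Everything follows from one statement about a single point \<open>z\<close> and a single radius \<open>\<rho>\<close>. List the
  \<open>r + s\<close> zeros of \<open>t\<^sup>r (b(t) - z)\<close> by increasing modulus as \<open>z\<^sub>1, z\<^sub>2, \<dots>\<close>. Then \<open>z\<close> lies outside the
  spectrum of \<open>T(b\<^sub>\<rho>)\<close> if and only if \<open>\<bar>z\<^sub>r\<bar> < \<rho> < \<bar>z\<^bsub>r+1\<^esub>\<bar>\<close> (\<open>mem_spectrum_dilate_iff\<close>). Hence \<open>z\<close> is in all the
  spectra exactly when the interval \<open>(\<bar>z\<^sub>r\<bar>, \<bar>z\<^bsub>r+1\<^esub>\<bar>)\<close> is empty, which is the definition of the limit set.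

  For the statement about one radius, sequences are read as power series and \<open>T(b\<^sub>\<rho>) - z\<close> becomes
  multiplication by a polynomial \<open>Q\<close> with zeros \<open>w\<^sub>j = z\<^sub>j / \<rho>\<close>, followed by \<open>r\<close> backward shifts. If exactly
  \<open>r\<close> zeros lie in the open disc and the others outside the closed disc, each of the former absorbs one
  backward shift, and the operator is a product of factors \<open>1 - w S\<^sup>*\<close> with \<open>\<bar>w\<bar> < 1\<close> and \<open>S - w\<close> with
  \<open>\<bar>w\<bar> > 1\<close>, all of them invertible. If the zeros are distributed differently, invertibility fails for
  an explicit reason: the reciprocal of the product over too many outer zeros lies in the kernel
  (\<open>toeplitz_poly_not_injective\<close>), too many zeros in the closed disc keep the first unit vector out of
  the range (\<open>toeplitz_poly_not_surjective\<close>), and if the \<open>r\<close>-th zero is on the circle, a harmonic sum keeps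
  some other vector out of it (\<open>backward_factor_not_surj\<close>).

  It remains to see that a nonempty interval \<open>(\<bar>z\<^sub>r\<bar>, \<bar>z\<^bsub>r+1\<^esub>\<bar>)\<close> always meets \<open>[\<rho>\<^sub>l, \<rho>\<^sub>h]\<close>. Let \<open>M\<close> be the sum of
  the moduli of the coefficients of \<open>b\<close>. If \<open>\<bar>z\<bar> \<le> M\<close>, the radius polynomials are made such that all zeros
  have moduli in \<open>[\<rho>\<^sub>l, \<rho>\<^sub>h]\<close>. If \<open>\<bar>z\<bar> > M\<close>, the coefficient of \<open>t\<^sup>r\<close> in \<open>t\<^sup>r (b(t) - z)\<close> dominates the sum of
  the others, and Pellet's theorem (\<open>dominant_coeff_separates\<close>) shows that the radius \<open>1\<close>, which lies
  between \<open>\<rho>\<^sub>l\<close> and \<open>\<rho>\<^sub>h\<close>, is in the interval. Pellet's theorem is itself a consequence of the kernel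
  construction: an operator with a dominant coefficient has no kernel, as a look at the largest
  coefficient of a kernel element shows.
\<close>

section \<open>Square-summable power series\<close>

text \<open>The sequence space is carried over to formal power series, the Hardy space, because there the
  forward shift is multiplication by \<^const>\<open>fps_X\<close> and the ring structure does the algebra of
  Toeplitz operators.\<close>

definition hardy :: "complex fps set" where
  "hardy = {F. fps_nth F \<in> ell2}"

definition hardy_norm :: "complex fps \<Rightarrow> real" where
  "hardy_norm F = ell2_norm (fps_nth F)"

definition partial_norm :: "nat \<Rightarrow> complex fps \<Rightarrow> real" where
  "partial_norm N F = L2_set (\<lambda>n. cmod (fps_nth F n)) {..<N}"

lemma partial_norm_nonneg [simp]: "0 \<le> partial_norm N F"
  by (simp add: partial_norm_def)

lemma partial_norm_le_hardy_norm:
  assumes "F \<in> hardy"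
  shows "partial_norm N F \<le> hardy_norm F"
  using assms unfolding partial_norm_def hardy_norm_def ell2_norm_def hardy_def ell2_def L2_set_def
  by (auto intro!: sum_le_suminf)

text \<open>Uniform bounds on the partial norms both give membership and transfer estimates to the norm.
  This is the way to bound a solution that is not yet known to be square-summable.\<close>

lemma hardyI:
  assumes "\<And>N. partial_norm N F \<le> C"
  shows "F \<in> hardy" and "hardy_norm F \<le> C"
proof -
  have C: "0 \<le> C"
    using assms[of 0] by (simp add: partial_norm_def)
  have bound: "(\<Sum>n<N. (cmod (fps_nth F n))\<^sup>2) \<le> C\<^sup>2" for N
    using assms[of N] C unfolding partial_norm_def L2_set_def
    by (metis real_sqrt_le_iff real_sqrt_abs abs_of_nonneg)
  have "summable (\<lambda>n. (cmod (fps_nth F n))\<^sup>2)"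
    by (rule summableI_nonneg_bounded[where x = "C\<^sup>2"]) (use bound in auto)
  then show "F \<in> hardy"
    by (simp add: hardy_def ell2_def)
  have "(\<Sum>n. (cmod (fps_nth F n))\<^sup>2) \<le> C\<^sup>2"
    by (rule suminf_le_const) (use bound \<open>summable _\<close> in auto)
  then have "sqrt (\<Sum>n. (cmod (fps_nth F n))\<^sup>2) \<le> sqrt (C\<^sup>2)"
    by (rule real_sqrt_le_mono)
  then show "hardy_norm F \<le> C"
    using C by (simp add: hardy_norm_def ell2_norm_def)
qed

lemma coeff_le_partial_norm: "n < N \<Longrightarrow> cmod (fps_nth F n) \<le> partial_norm N F"
  unfolding partial_norm_def by (rule member_le_L2_set) auto

lemma coeff_le_hardy_norm: "F \<in> hardy \<Longrightarrow> cmod (fps_nth F n) \<le> hardy_norm F"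
  using coeff_le_partial_norm[of n "Suc n" F] partial_norm_le_hardy_norm[of F "Suc n"] by simp

lemma partial_norm_add: "partial_norm N (F + G) \<le> partial_norm N F + partial_norm N G"
proof -
  have "partial_norm N (F + G) \<le> L2_set (\<lambda>n. cmod (fps_nth F n) + cmod (fps_nth G n)) {..<N}"
    unfolding partial_norm_def by (rule L2_set_mono) (auto simp: norm_triangle_ineq)
  also have "\<dots> \<le> partial_norm N F + partial_norm N G"
    unfolding partial_norm_def by (rule L2_set_triangle_ineq)
  finally show ?thesis .
qed

lemma partial_norm_const_mult: "partial_norm N (fps_const c * F) = cmod c * partial_norm N F"
  by (simp add: partial_norm_def norm_mult L2_set_right_distrib)

lemma partial_norm_Suc_le: "partial_norm (Suc N) F \<le> partial_norm N F + cmod (fps_nth F N)"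
  unfolding partial_norm_def
  by (simp add: lessThan_Suc sqrt_sum_squares_le_sum_abs L2_set_insert)
     (metis L2_set_nonneg add.commute norm_ge_zero sqrt_sum_squares_le_sum)

lemma partial_norm_fps_X: "partial_norm N (fps_X * F) \<le> partial_norm N F"
proof (cases N)
  case (Suc M)
  have "(\<Sum>n<N. (cmod (fps_nth (fps_X * F) n))\<^sup>2) = (\<Sum>n<M. (cmod (fps_nth F n))\<^sup>2)"
    by (simp add: Suc sum.lessThan_Suc_shift del: sum.lessThan_Suc)
  also have "\<dots> \<le> (\<Sum>n<N. (cmod (fps_nth F n))\<^sup>2)"
    by (simp add: Suc)
  finally show ?thesis
    by (simp add: partial_norm_def L2_set_def)
qed (simp add: partial_norm_def)

lemma partial_norm_shift: "partial_norm N (fps_shift 1 F) \<le> partial_norm (Suc N) F"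
  unfolding partial_norm_def L2_set_def
  by (simp add: sum.lessThan_Suc_shift del: sum.lessThan_Suc)

lemma hardy_add: "F \<in> hardy \<Longrightarrow> G \<in> hardy \<Longrightarrow> F + G \<in> hardy"
  and hardy_norm_add:
    "F \<in> hardy \<Longrightarrow> G \<in> hardy \<Longrightarrow> hardy_norm (F + G) \<le> hardy_norm F + hardy_norm G"
proof -
  have *: "partial_norm N (F + G) \<le> hardy_norm F + hardy_norm G" if "F \<in> hardy" "G \<in> hardy" for N
    using partial_norm_add[of N F G] partial_norm_le_hardy_norm[OF that(1), of N]
      partial_norm_le_hardy_norm[OF that(2), of N] by linarith
  show "F \<in> hardy \<Longrightarrow> G \<in> hardy \<Longrightarrow> F + G \<in> hardy"
    by (rule hardyI) (rule *)
  show "F \<in> hardy \<Longrightarrow> G \<in> hardy \<Longrightarrow> hardy_norm (F + G) \<le> hardy_norm F + hardy_norm G"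
    by (rule hardyI) (rule *)
qed

lemma hardy_const_mult: "F \<in> hardy \<Longrightarrow> fps_const c * F \<in> hardy"
  and hardy_norm_const_mult_le:
    "F \<in> hardy \<Longrightarrow> hardy_norm (fps_const c * F) \<le> cmod c * hardy_norm F"
proof -
  have *: "partial_norm N (fps_const c * F) \<le> cmod c * hardy_norm F" if "F \<in> hardy" for N
    using partial_norm_le_hardy_norm[OF that, of N]
    by (simp add: partial_norm_const_mult mult_left_mono)
  show "F \<in> hardy \<Longrightarrow> fps_const c * F \<in> hardy"
    by (rule hardyI) (rule *)
  show "F \<in> hardy \<Longrightarrow> hardy_norm (fps_const c * F) \<le> cmod c * hardy_norm F"
    by (rule hardyI) (rule *)
qed

lemma hardy_diff: "F \<in> hardy \<Longrightarrow> G \<in> hardy \<Longrightarrow> F - G \<in> hardy"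
  using hardy_add[of F "fps_const (-1) * G"] hardy_const_mult[of G "-1"]
  by (simp flip: fps_const_neg)

lemma hardy_fps_X: "F \<in> hardy \<Longrightarrow> fps_X * F \<in> hardy"
  by (rule hardyI[of _ "hardy_norm F"])
     (meson order_trans partial_norm_fps_X partial_norm_le_hardy_norm)

lemma hardy_shift1: "F \<in> hardy \<Longrightarrow> fps_shift 1 F \<in> hardy"
  and hardy_norm_shift1: "F \<in> hardy \<Longrightarrow> hardy_norm (fps_shift 1 F) \<le> hardy_norm F"
proof -
  have *: "partial_norm N (fps_shift 1 F) \<le> hardy_norm F" if "F \<in> hardy" for N
    using partial_norm_shift[of N F] partial_norm_le_hardy_norm[OF that, of "Suc N"] by linarith
  show "F \<in> hardy \<Longrightarrow> fps_shift 1 F \<in> hardy"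
    by (rule hardyI) (rule *)
  show "F \<in> hardy \<Longrightarrow> hardy_norm (fps_shift 1 F) \<le> hardy_norm F"
    by (rule hardyI) (rule *)
qed

lemma hardy_shift: "F \<in> hardy \<Longrightarrow> fps_shift k F \<in> hardy"
proof (induction k)
  case (Suc k)
  have "fps_shift (Suc k) F = fps_shift 1 (fps_shift k F)"
    by (simp add: fps_eq_iff)
  then show ?case
    using Suc hardy_shift1 by simp
qed simp

lemma hardy_zero: "0 \<in> hardy"
  by (simp add: hardy_def ell2_def)

lemma hardy_poly_mult:
  assumes "F \<in> hardy"
  shows "fps_of_poly p * F \<in> hardy"
proof (induction p)
  case (pCons a p)
  have "fps_of_poly (pCons a p) * F = fps_const a * F + fps_X * (fps_of_poly p * F)"
    by (simp add: fps_of_poly_pCons algebra_simps)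
  then show ?case
    using pCons assms by (simp add: hardy_add hardy_const_mult hardy_fps_X)
qed (simp add: hardy_zero)

lemma hardy_one: "1 \<in> hardy"
proof -
  have "summable (\<lambda>n. (cmod (fps_nth 1 n))\<^sup>2)"
    by (rule summable_finite[of "{0}"]) auto
  then show ?thesis
    by (simp add: hardy_def ell2_def)
qed

lemma hardy_of_poly: "fps_of_poly p \<in> hardy"
  using hardy_poly_mult[OF hardy_one, of p] by simp

lemma hardy_coeff_tendsto_zero:
  assumes "F \<in> hardy"
  shows "(\<lambda>n. cmod (fps_nth F n)) \<longlonglongrightarrow> 0"
proof -
  have "(\<lambda>n. (cmod (fps_nth F n))\<^sup>2) \<longlonglongrightarrow> 0"
    using assms by (intro summable_LIMSEQ_zero) (simp add: hardy_def ell2_def)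
  then have "(\<lambda>n. sqrt ((cmod (fps_nth F n))\<^sup>2)) \<longlonglongrightarrow> sqrt 0"
    by (rule tendsto_real_sqrt)
  then show ?thesis by simp
qed

section \<open>Invertibility of the elementary factors\<close>

text \<open>For bijective linear operators the last condition is the boundedness of the inverse. It is
  part of the notion, because it passes to compositions along with bijectivity.\<close>

definition hardy_iso :: "(complex fps \<Rightarrow> complex fps) \<Rightarrow> bool" where
  "hardy_iso A \<longleftrightarrow> bij_betw A hardy hardy \<and>
     (\<exists>K>0. \<forall>F\<in>hardy. hardy_norm F \<le> K * hardy_norm (A F))"

lemma bij_hardy_surj: "bij_betw A hardy hardy \<Longrightarrow> G \<in> hardy \<Longrightarrow> \<exists>F\<in>hardy. A F = G"
  unfolding bij_betw_def by (metis imageE)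

lemma hardy_iso_compose:
  assumes "hardy_iso A" and "hardy_iso B"
  shows "hardy_iso (\<lambda>F. A (B F))"
proof -
  obtain K L where KL: "K > 0" "L > 0"
    and K: "\<And>F. F \<in> hardy \<Longrightarrow> hardy_norm F \<le> K * hardy_norm (A F)"
    and L: "\<And>F. F \<in> hardy \<Longrightarrow> hardy_norm F \<le> L * hardy_norm (B F)"
    using assms by (auto simp: hardy_iso_def)
  have bij: "bij_betw (\<lambda>F. A (B F)) hardy hardy"
    using assms bij_betw_trans[of B hardy hardy A hardy] by (simp add: hardy_iso_def comp_def)
  have "hardy_norm F \<le> (L * K) * hardy_norm (A (B F))" if "F \<in> hardy" for F
  proof -
    have "B F \<in> hardy"
      using assms that by (auto simp: hardy_iso_def bij_betw_def)
    then show ?thesis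
      using order_trans[OF L[OF that] mult_left_mono[OF K[of "B F"], of L]] KL
      by (simp add: mult.assoc)
  qed
  then show ?thesis
    unfolding hardy_iso_def using bij KL by (intro conjI exI[of _ "L * K"]) auto
qed

lemma hardy_isoI:
  assumes lin: "\<And>F G. A (F - G) = A F - A G"
    and closed: "\<And>F. F \<in> hardy \<Longrightarrow> A F \<in> hardy"
    and surj: "\<And>G. G \<in> hardy \<Longrightarrow> \<exists>F\<in>hardy. A F = G"
    and c: "c > 0" and lower: "\<And>F. F \<in> hardy \<Longrightarrow> c * hardy_norm F \<le> hardy_norm (A F)"
  shows "hardy_iso A"
proof -
  have "F = G" if "F \<in> hardy" "G \<in> hardy" "A F = A G" for F G
  proof -
    have H: "F - G \<in> hardy" and A0: "A (F - G) = 0"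
      using that lin hardy_diff by auto
    have "c * hardy_norm (F - G) \<le> 0"
      using lower[OF H] A0 by (simp add: hardy_norm_def ell2_norm_def)
    then have "hardy_norm (F - G) \<le> 0"
      using c by (simp add: mult_le_0_iff)
    then have "fps_nth (F - G) n = 0" for n
      using coeff_le_hardy_norm[OF H, of n] by (metis norm_le_zero_iff order_trans)
    then show ?thesis
      by (simp add: fps_eq_iff)
  qed
  then have "bij_betw A hardy hardy"
    using closed surj by (auto simp: bij_betw_def inj_on_def image_iff) metis
  moreover have "hardy_norm F \<le> inverse c * hardy_norm (A F)" if "F \<in> hardy" for F
    using lower[OF that] c by (simp add: field_simps)
  ultimately show ?thesis
    unfolding hardy_iso_def using c by (intro conjI exI[of _ "inverse c"]) auto
qed

lemma hardy_iso_const: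
  assumes "c \<noteq> 0"
  shows "hardy_iso (\<lambda>F. fps_const c * F)"
proof (rule hardy_isoI[where c = "cmod c"])
  fix G :: "complex fps"
  show "\<exists>F\<in>hardy. fps_const c * F = G" if "G \<in> hardy"
    using that assms
    by (intro bexI[of _ "fps_const (inverse c) * G"])
       (simp_all add: hardy_const_mult fps_eq_iff)
  show "cmod c * hardy_norm G \<le> hardy_norm (fps_const c * G)" if "G \<in> hardy"
  proof -
    have "fps_const (inverse c) * (fps_const c * G) = G"
      using assms by (simp add: fps_eq_iff)
    then have "hardy_norm G \<le> cmod (inverse c) * hardy_norm (fps_const c * G)"
      using hardy_norm_const_mult_le[OF hardy_const_mult[OF that], of "inverse c" c] by metis
    from mult_left_mono[OF this, of "cmod c"] show ?thesis
      using assms by (simp add: norm_inverse mult.assoc[symmetric])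
  qed
qed (use assms in \<open>auto simp: right_diff_distrib hardy_const_mult\<close>)

text \<open>If \<open>G = (X - w) F\<close>, then \<open>w F = X F - G\<close>, and \<open>X\<close> does not increase norms. This bounds \<open>F\<close>
  by \<open>G\<close> as soon as \<open>\<bar>w\<bar> > 1\<close>.\<close>

lemma partial_norm_divide_linear:
  "(cmod w - 1) * partial_norm N F \<le> partial_norm N ((fps_X - fps_const w) * F)"
proof -
  have "fps_const w * F = fps_X * F + fps_const (-1) * ((fps_X - fps_const w) * F)"
    by (simp add: algebra_simps flip: fps_const_neg)
  then have "cmod w * partial_norm N F
      \<le> partial_norm N (fps_X * F) + partial_norm N ((fps_X - fps_const w) * F)"
    using partial_norm_add[of N "fps_X * F" "fps_const (-1) * ((fps_X - fps_const w) * F)"]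
      partial_norm_const_mult[of N w F]
      partial_norm_const_mult[of N "-1" "(fps_X - fps_const w) * F"] by simp
  then show ?thesis
    using partial_norm_fps_X[of N F] by (simp add: algebra_simps)
qed

lemma hardy_divide_linear:
  assumes "1 < cmod w" and "G \<in> hardy"
  shows "\<exists>F\<in>hardy. (fps_X - fps_const w) * F = G"
proof -
  define F where "F = inverse (fps_X - fps_const w) * G"
  have "fps_nth (fps_X - fps_const w) 0 \<noteq> 0"
    using assms(1) by auto
  then have F: "(fps_X - fps_const w) * F = G"
    by (simp add: F_def mult.assoc[symmetric] inverse_mult_eq_1')
  have "partial_norm N F \<le> hardy_norm G / (cmod w - 1)" for N
    using partial_norm_divide_linear[of w N F] partial_norm_le_hardy_norm[OF assms(2), of N] assms(1)
    unfolding F by (simp add: pos_le_divide_eq mult.commute)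
  then show ?thesis
    using F hardyI(1) by blast
qed

lemma hardy_iso_linear:
  assumes "1 < cmod w"
  shows "hardy_iso (\<lambda>F. (fps_X - fps_const w) * F)"
proof (rule hardy_isoI[where c = "cmod w - 1"])
  show closed: "(fps_X - fps_const w) * F \<in> hardy" if "F \<in> hardy" for F
    using that by (simp add: left_diff_distrib hardy_diff hardy_fps_X hardy_const_mult)
  show "(cmod w - 1) * hardy_norm F \<le> hardy_norm ((fps_X - fps_const w) * F)" if "F \<in> hardy" for F
  proof -
    have "partial_norm N F \<le> hardy_norm ((fps_X - fps_const w) * F) / (cmod w - 1)" for N
      using partial_norm_divide_linear[of w N F] assms
        partial_norm_le_hardy_norm[OF closed[OF that], of N]
      by (simp add: field_simps)
    then have "hardy_norm F \<le> hardy_norm ((fps_X - fps_const w) * F) / (cmod w - 1)"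
      by (rule hardyI)
    then show ?thesis
      using assms by (simp add: field_simps)
  qed
  show "\<exists>F\<in>hardy. (fps_X - fps_const w) * F = G" if "G \<in> hardy" for G
    using hardy_divide_linear[OF assms that] .
qed (use assms in \<open>auto simp: algebra_simps\<close>)

definition backward_factor :: "complex \<Rightarrow> complex fps \<Rightarrow> complex fps" where
  "backward_factor w F = F - fps_const w * fps_shift 1 F"

text \<open>The inverse is the Neumann series \<open>\<Sum>k. w\<^sup>k (S\<^sup>*)\<^sup>k\<close> of the backward shift \<open>S\<^sup>*\<close>. It is evaluated
  coefficientwise; its square-summability comes from the recursion \<open>F = G + w S\<^sup>* F\<close>, in which the
  coefficient that the backward shift adds to a partial norm is bounded.\<close>

lemma backward_factor_surj:
  assumes w: "cmod w < 1" and G: "G \<in> hardy"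
  shows "\<exists>F\<in>hardy. backward_factor w F = G"
proof -
  define f where "f n k = w ^ k * fps_nth G (n + k)" for n k
  define F where "F = Abs_fps (\<lambda>n. \<Sum>k. f n k)"
  have geo: "summable (\<lambda>k. hardy_norm G * cmod w ^ k)"
    using w by (intro summable_mult summable_geometric) simp
  have f_le: "cmod (f n k) \<le> hardy_norm G * cmod w ^ k" for n k
    using coeff_le_hardy_norm[OF G, of "n + k"]
    by (simp add: f_def norm_mult norm_power mult.commute[of "hardy_norm G"] mult_left_mono)
  have summable_norm_f: "summable (\<lambda>k. cmod (f n k))" for n
    by (rule summable_comparison_test'[OF geo, of 0]) (use f_le in auto)
  then have summable_f: "summable (f n)" for n
    by (rule summable_norm_cancel)
  have eq: "backward_factor w F = G"
  proof (rule fps_ext)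
    fix n
    have "(\<Sum>k. f n k) = f n 0 + (\<Sum>k. f n (Suc k))"
      using suminf_split_head[OF summable_f[of n]] by simp
    also have "(\<Sum>k. f n (Suc k)) = (\<Sum>k. w * f (Suc n) k)"
      by (simp add: f_def mult.assoc)
    also have "\<dots> = w * (\<Sum>k. f (Suc n) k)"
      by (rule suminf_mult[OF summable_f])
    finally show "fps_nth (backward_factor w F) n = fps_nth G n"
      by (simp add: backward_factor_def F_def f_def)
  qed
  define C where "C = (\<Sum>k. hardy_norm G * cmod w ^ k)"
  have coeff_le: "cmod (fps_nth F n) \<le> C" for n
  proof -
    have "cmod (fps_nth F n) \<le> (\<Sum>k. cmod (f n k))"
      by (simp add: F_def summable_norm[OF summable_norm_f])
    also have "\<dots> \<le> C"
      unfolding C_def by (rule suminf_le[OF f_le summable_norm_f geo])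
    finally show ?thesis .
  qed
  have "partial_norm N F \<le> (hardy_norm G + cmod w * C) / (1 - cmod w)" for N
  proof -
    have "F = G + fps_const w * fps_shift 1 F"
      using eq by (auto simp: backward_factor_def)
    then have "partial_norm N F \<le> partial_norm N G + cmod w * partial_norm N (fps_shift 1 F)"
      using partial_norm_add[of N G "fps_const w * fps_shift 1 F"]
      by (simp add: partial_norm_const_mult)
    also have "\<dots> \<le> hardy_norm G + cmod w * (partial_norm N F + C)"
    proof (intro add_mono mult_left_mono)
      show "partial_norm N (fps_shift 1 F) \<le> partial_norm N F + C"
        using partial_norm_shift[of N F] partial_norm_Suc_le[of N F] coeff_le[of N] by linarith
    qed (use partial_norm_le_hardy_norm[OF G] in auto)
    finally show ?thesis
      using w by (simp add: field_simps)
  qed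
  then have "F \<in> hardy"
    by (rule hardyI)
  with eq show ?thesis by blast
qed

lemma hardy_backward_factor: "F \<in> hardy \<Longrightarrow> backward_factor w F \<in> hardy"
  unfolding backward_factor_def by (intro hardy_diff hardy_const_mult hardy_shift1)

lemma hardy_iso_backward_factor:
  assumes "cmod w < 1"
  shows "hardy_iso (backward_factor w)"
proof (rule hardy_isoI[where c = "1 - cmod w"])
  show "(1 - cmod w) * hardy_norm F \<le> hardy_norm (backward_factor w F)" if "F \<in> hardy" for F
  proof -
    have S: "fps_shift 1 F \<in> hardy" and B: "backward_factor w F \<in> hardy"
      using that hardy_shift1 hardy_backward_factor by auto
    have "F = backward_factor w F + fps_const w * fps_shift 1 F"
      by (simp add: backward_factor_def)
    then have "hardy_norm F \<le> hardy_norm (backward_factor w F) + hardy_norm (fps_const w * fps_shift 1 F)"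
      using hardy_norm_add[OF B hardy_const_mult[OF S]] by metis
    also have "hardy_norm (fps_const w * fps_shift 1 F) \<le> cmod w * hardy_norm F"
      using hardy_norm_const_mult_le[OF S, of w]
        mult_left_mono[OF hardy_norm_shift1[OF that], of "cmod w"] by simp
    finally show ?thesis
      by (simp add: algebra_simps)
  qed
  show "backward_factor w (F - G) = backward_factor w F - backward_factor w G" for F G
    by (simp add: backward_factor_def fps_shift_diff algebra_simps)
qed (use assms in \<open>auto simp: hardy_backward_factor backward_factor_surj\<close>)

text \<open>A square-summable right-hand side outside the range is \<open>G\<^sub>n = w\<^bsup>-n\<^esup> / (n + 1)\<close>. The equation
  \<open>F\<^sub>n - w F\<^bsub>n+1\<^esub> = G\<^sub>n\<close> forces \<open>w\<^sup>n F\<^sub>n = F\<^sub>0 - (1 + 1/2 + \<dots> + 1/n)\<close>, which diverges.\<close>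

lemma backward_factor_not_surj:
  assumes w: "cmod w = 1"
  shows "\<exists>G\<in>hardy. \<forall>F\<in>hardy. backward_factor w F \<noteq> G"
proof -
  define G where "G = Abs_fps (\<lambda>n. inverse w ^ n / of_nat (Suc n))"
  have norm_G: "(cmod (fps_nth G n))\<^sup>2 = 1 / (real (Suc n))\<^sup>2" for n
    using w by (simp add: G_def norm_divide norm_power norm_inverse power_divide
        del: of_nat_Suc)
  have "summable (\<lambda>n. 1 / (real (Suc n))\<^sup>2)"
    using inverse_squares_sums by (simp add: sums_iff add.commute)
  then have G: "G \<in> hardy"
    by (simp only: hardy_def ell2_def mem_Collect_eq norm_G)
  have "backward_factor w F \<noteq> G" if "F \<in> hardy" for F
  proof
    assume eq: "backward_factor w F = G"
    have w0: "w \<noteq> 0"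
      using w by auto
    have rec: "w ^ Suc n * fps_nth F (Suc n) = w ^ n * fps_nth F n - inverse (of_nat (Suc n))" for n
    proof -
      have "fps_nth F n - w * fps_nth F (Suc n) = inverse w ^ n / of_nat (Suc n)"
        using arg_cong[OF eq, of "\<lambda>H. fps_nth H n"] by (simp add: backward_factor_def G_def)
      then have "w ^ n * (fps_nth F n - w * fps_nth F (Suc n)) = inverse (of_nat (Suc n))"
        using w0 by (simp add: inverse_eq_divide flip: power_mult_distrib)
      then show ?thesis
        by (simp add: algebra_simps)
    qed
    have "(\<Sum>k<n. inverse (of_nat (Suc k)) :: complex) = fps_nth F 0 - w ^ n * fps_nth F n" for n
    proof (induction n)
      case (Suc n)
      then show ?case
        using rec[of n] by (simp only: sum.lessThan_Suc) (simp add: algebra_simps)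
    qed simp
    moreover have "(\<lambda>n. w ^ n * fps_nth F n) \<longlonglongrightarrow> 0"
      using hardy_coeff_tendsto_zero[OF that] w
      by (intro tendsto_norm_zero_cancel[of "\<lambda>n. w ^ n * fps_nth F n"])
         (simp add: norm_mult norm_power)
    ultimately have "(\<lambda>n. inverse (of_nat (Suc n)) :: complex) sums (fps_nth F 0 - 0)"
      unfolding sums_def by (simp only:) (intro tendsto_diff tendsto_const)
    then have "summable (\<lambda>n. inverse (of_nat (Suc n)) :: complex)"
      by (rule sums_summable)
    then have "summable (\<lambda>n. inverse (of_nat n) :: complex)"
      by (subst (asm) summable_Suc_iff)
    then show False
      using not_summable_harmonic by blast
  qed
  with G show ?thesis by blast
qed

section \<open>Toeplitz operators with polynomial symbol\<close>

definition root_poly :: "complex list \<Rightarrow> complex poly" where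
  "root_poly ws = (\<Prod>w\<leftarrow>ws. [:- w, 1:])"

text \<open>This is the Toeplitz operator with symbol \<open>t\<^bsup>-r\<^esup> Q(t)\<close>.\<close>

definition toeplitz_poly :: "nat \<Rightarrow> complex poly \<Rightarrow> complex fps \<Rightarrow> complex fps" where
  "toeplitz_poly r Q F = fps_shift r (fps_of_poly Q * F)"

lemma root_poly_Nil [simp]: "root_poly [] = 1"
  and root_poly_Cons [simp]: "root_poly (w # ws) = [:- w, 1:] * root_poly ws"
  and root_poly_append: "root_poly (us @ ws) = root_poly us * root_poly ws"
  by (simp_all add: root_poly_def del: mult_pCons_left mult_pCons_right)

lemma root_poly_nonzero [simp]: "root_poly ws \<noteq> 0"
  by (induction ws) (simp_all del: mult_pCons_left mult_pCons_right)

lemma degree_root_poly [simp]: "degree (root_poly ws) = length ws"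
  by (induction ws) (simp_all add: degree_mult_eq del: mult_pCons_left mult_pCons_right)

lemma poly_root_poly_eq_0: "w \<in> set ws \<Longrightarrow> poly (root_poly ws) w = 0"
  by (induction ws) auto

lemma coeff_0_root_poly: "0 \<notin> set ws \<Longrightarrow> coeff (root_poly ws) 0 \<noteq> 0"
  by (induction ws) (auto simp: coeff_mult)

lemma fps_of_linear_poly: "fps_of_poly [:- w, 1:] = fps_X - fps_const (w :: complex)"
  by (auto simp: fps_eq_iff coeff_pCons split: nat.split)

lemma hardy_toeplitz_poly: "F \<in> hardy \<Longrightarrow> toeplitz_poly r Q F \<in> hardy"
  by (simp add: toeplitz_poly_def hardy_shift hardy_poly_mult)

lemma toeplitz_poly_mult:
  "toeplitz_poly r (P * Q) F = toeplitz_poly r P (fps_of_poly Q * F)"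
  by (simp add: toeplitz_poly_def fps_of_poly_mult mult.assoc)

lemma toeplitz_poly_linear_mult:
  "toeplitz_poly (Suc r) ([:- w, 1:] * Q) F = backward_factor w (toeplitz_poly r Q F)"
proof -
  have "fps_of_poly ([:- w, 1:] * Q) * F
      = fps_X * (fps_of_poly Q * F) - fps_const w * (fps_of_poly Q * F)"
    by (simp add: fps_of_poly_mult fps_of_linear_poly algebra_simps
        del: mult_pCons_left mult_pCons_right)
  then show ?thesis
    by (simp add: toeplitz_poly_def backward_factor_def fps_eq_iff
        del: mult_pCons_left mult_pCons_right)
qed

text \<open>One backward shift turns one factor \<open>S - w\<close> into \<open>1 - w S\<^sup>*\<close>. The \<open>r\<close> zeros in the disc
  absorb all \<open>r\<close> backward shifts; this is the Wiener-Hopf factorisation of the symbol.\<close>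

lemma hardy_iso_inner_zeros:
  assumes "\<forall>w\<in>set us. cmod w < 1"
  shows "hardy_iso (toeplitz_poly (length us) (root_poly us))"
  using assms
proof (induction us)
  case Nil
  have "toeplitz_poly 0 1 = id"
    by (simp add: toeplitz_poly_def fun_eq_iff)
  then show ?case
    by (auto simp: hardy_iso_def bij_betw_def intro!: exI[of _ 1])
next
  case (Cons w us)
  have "toeplitz_poly (length (w # us)) (root_poly (w # us))
      = (\<lambda>F. backward_factor w (toeplitz_poly (length us) (root_poly us) F))"
    by (simp add: fun_eq_iff toeplitz_poly_linear_mult del: mult_pCons_left mult_pCons_right)
  then show ?case
    using Cons hardy_iso_compose[OF hardy_iso_backward_factor] by simp
qed

lemma hardy_iso_outer_zeros:
  assumes "\<forall>w\<in>set vs. 1 < cmod w"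
  shows "hardy_iso (\<lambda>F. fps_of_poly (root_poly vs) * F)"
  using assms
proof (induction vs)
  case Nil
  have "(\<lambda>F. fps_of_poly (root_poly []) * F) = id"
    by (simp add: fun_eq_iff)
  then show ?case
    by (auto simp: hardy_iso_def bij_betw_def intro!: exI[of _ 1])
next
  case (Cons w vs)
  have "(\<lambda>F. fps_of_poly (root_poly (w # vs)) * F)
      = (\<lambda>F. (fps_X - fps_const w) * (fps_of_poly (root_poly vs) * F))"
    by (simp add: fps_of_poly_mult fps_of_linear_poly mult.assoc
        del: mult_pCons_left mult_pCons_right)
  then show ?case
    using Cons hardy_iso_compose[OF hardy_iso_linear] by simp
qed

lemma hardy_iso_toeplitz_poly:
  assumes "c \<noteq> 0" and "\<forall>w\<in>set us. cmod w < 1" and "\<forall>w\<in>set vs. 1 < cmod w"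
  shows "hardy_iso (toeplitz_poly (length us) (smult c (root_poly us * root_poly vs)))"
proof -
  have "toeplitz_poly (length us) (smult c (root_poly us * root_poly vs))
      = (\<lambda>F. fps_const c * toeplitz_poly (length us) (root_poly us) (fps_of_poly (root_poly vs) * F))"
    by (simp add: fun_eq_iff toeplitz_poly_def fps_of_poly_smult fps_of_poly_mult mult.assoc
        fps_eq_iff)
  then show ?thesis
    using hardy_iso_compose[OF hardy_iso_const[OF assms(1)]
        hardy_iso_compose[OF hardy_iso_inner_zeros[OF assms(2)] hardy_iso_outer_zeros[OF assms(3)]]]
    by simp
qed

section \<open>Obstructions to invertibility\<close>

text \<open>Let \<open>V\<close> be the product over zeros outside the closed disc. Its reciprocal is
  square-summable, and multiplication by the whole polynomial turns it into the complementary
  factor, whose degree is below \<open>r\<close>; the backward shifts annihilate this.\<close>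

lemma toeplitz_poly_not_injective:
  assumes vs: "\<forall>w\<in>set vs. 1 < cmod w" and deg: "degree A < r"
  shows "\<exists>F\<in>hardy. F \<noteq> 0 \<and> toeplitz_poly r (A * root_poly vs) F = 0"
proof -
  obtain F where F: "F \<in> hardy" "fps_of_poly (root_poly vs) * F = 1"
    using hardy_iso_outer_zeros[OF vs] bij_hardy_surj[OF _ hardy_one] unfolding hardy_iso_def
    by blast
  have "toeplitz_poly r (A * root_poly vs) F = 0"
    using deg by (simp add: toeplitz_poly_mult F(2)) (simp add: toeplitz_poly_def fps_eq_iff coeff_eq_0)
  then show ?thesis
    using F by (intro bexI[of _ F]) auto
qed

text \<open>Dividing \<open>R\<close> by \<open>X - w\<close> leaves the remainder \<open>R(w)\<close>, so the difference \<open>H\<close> of \<open>F\<close> and the quotient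
  satisfies \<open>(X - w) H = R(w)\<close>, that is \<open>w\<^bsup>n+1\<^esup> H\<^sub>n = - R(w)\<close>. For \<open>\<bar>w\<bar> \<le> 1\<close> the coefficients of \<open>H\<close> can
  tend to zero only if \<open>R(w) = 0\<close>.\<close>

lemma linear_factor_dvd_poly:
  assumes w: "cmod w \<le> 1" and F: "F \<in> hardy"
    and eq: "fps_of_poly R = (fps_X - fps_const w) * F"
  shows "\<exists>T. R = [:- w, 1:] * T \<and> F = fps_of_poly T"
proof -
  define c where "c = poly R w"
  have "[:- w, 1:] dvd R - [:c:]"
    by (simp add: c_def dvd_iff_poly_eq_0)
  then obtain T where T: "R - [:c:] = [:- w, 1:] * T"
    by (elim dvdE)
  define H where "H = F - fps_of_poly T"
  have H: "H \<in> hardy"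
    by (simp add: H_def F hardy_diff hardy_of_poly)
  have RT: "fps_of_poly R - fps_const c = (fps_X - fps_const w) * fps_of_poly T"
    using arg_cong[OF T, of fps_of_poly]
    by (simp add: fps_of_poly_diff fps_of_poly_const fps_of_poly_mult fps_of_linear_poly
        del: mult_pCons_left mult_pCons_right)
  have H_eq: "(fps_X - fps_const w) * H = fps_const c"
    using RT by (simp add: H_def right_diff_distrib flip: eq) (simp add: algebra_simps)
  have coeff: "fps_nth (fps_X * H) n - w * fps_nth H n = fps_nth (fps_const c) n" for n
    using arg_cong[OF H_eq, of "\<lambda>G. fps_nth G n"] by (simp add: left_diff_distrib)
  have rec: "w ^ Suc n * fps_nth H n = - c" for n
  proof (induction n)
    case 0
    then show ?case
      using coeff[of 0] by (simp add: minus_equation_iff eq_commute)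
  next
    case (Suc n)
    have "fps_nth H n = w * fps_nth H (Suc n)"
      using coeff[of "Suc n"] by simp
    then show ?case
      using Suc by (simp add: mult_ac)
  qed
  have "cmod c \<le> cmod (fps_nth H n)" for n
  proof -
    have "cmod c = cmod w ^ Suc n * cmod (fps_nth H n)"
      using rec[of n] by (metis norm_minus_cancel norm_mult norm_power)
    also have "\<dots> \<le> 1 * cmod (fps_nth H n)"
      by (rule mult_right_mono) (use w power_le_one[of "cmod w" "Suc n"] in auto)
    finally show ?thesis by simp
  qed
  then have "cmod c \<le> 0"
    by (intro LIMSEQ_le_const[OF hardy_coeff_tendsto_zero[OF H]]) auto
  then have c0: "c = 0"
    by simp
  then have "H = 0"
    using H_eq by (metis fps_X_neq_fps_const fps_const_0_eq_0 mult_eq_0_iff eq_iff_diff_eq_0)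
  then show ?thesis
    using T c0 by (intro exI[of _ T]) (simp add: H_def)
qed

lemma root_poly_dvd_poly:
  assumes "\<forall>w\<in>set us. cmod w \<le> 1" and "F \<in> hardy"
    and "fps_of_poly R = fps_of_poly (root_poly us) * F"
  shows "root_poly us dvd R"
  using assms
proof (induction us arbitrary: R)
  case (Cons w us)
  have "fps_of_poly R = (fps_X - fps_const w) * (fps_of_poly (root_poly us) * F)"
    using Cons.prems by (simp add: fps_of_poly_mult fps_of_linear_poly mult.assoc
        del: mult_pCons_left mult_pCons_right)
  then obtain T where "R = [:- w, 1:] * T" "fps_of_poly (root_poly us) * F = fps_of_poly T"
    using linear_factor_dvd_poly[of w "fps_of_poly (root_poly us) * F" R] Cons.prems hardy_poly_mult
    by (auto simp del: mult_pCons_left mult_pCons_right)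
  moreover have "root_poly us dvd T"
    using Cons.IH[of T] Cons.prems calculation by simp
  ultimately show ?case
    by (simp add: mult_dvd_mono del: mult_pCons_left mult_pCons_right)
qed simp

text \<open>If the unit vector \<open>1\<close> were in the range, then \<open>Q F\<close> would be a polynomial of degree exactly
  \<open>r\<close>, yet divisible by the more than \<open>r\<close> linear factors of \<open>Q\<close> with zeros in the closed disc.\<close>

lemma toeplitz_poly_not_surjective:
  assumes us: "\<forall>w\<in>set us. cmod w \<le> 1" and len: "r < length us" and F: "F \<in> hardy"
  shows "toeplitz_poly r (root_poly us * A) F \<noteq> 1"
proof
  assume eq: "toeplitz_poly r (root_poly us * A) F = 1"
  define G where "G = fps_of_poly (root_poly us * A) * F"
  define R where "R = poly_of_list (map (fps_nth G) [0..<Suc r])"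
  have coeff_G: "fps_nth G (n + r) = (if n = 0 then 1 else 0)" for n
    using arg_cong[OF eq, of "\<lambda>H. fps_nth H n"] by (simp add: toeplitz_poly_def G_def)
  have coeff_R: "coeff R n = (if n \<le> r then fps_nth G n else 0)" for n
    by (simp add: R_def coeff_Poly_eq nth_default_def del: upt_Suc) 
  have "fps_of_poly R = G"
  proof (rule fps_ext)
    fix n
    show "fps_nth (fps_of_poly R) n = fps_nth G n"
      using coeff_G[of "n - r"] by (cases "n \<le> r") (auto simp: coeff_R)
  qed
  moreover have "G = fps_of_poly (root_poly us) * (fps_of_poly A * F)"
    by (simp add: G_def fps_of_poly_mult mult.assoc)
  ultimately have "root_poly us dvd R"
    using root_poly_dvd_poly[OF us hardy_poly_mult[OF F, of A]] by simp
  moreover have "coeff R r = 1"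
    using coeff_G[of 0] by (simp add: coeff_R)
  then have "R \<noteq> 0" by auto
  moreover have "degree R \<le> r"
    by (rule degree_le) (simp add: coeff_R)
  ultimately show False
    using len dvd_imp_degree_le[of "root_poly us" R] by simp
qed

lemma toeplitz_poly_not_surjective_unimodular:
  assumes "cmod w = 1" and "r > 0"
  shows "\<exists>G\<in>hardy. \<forall>F\<in>hardy. toeplitz_poly r ([:- w, 1:] * A) F \<noteq> G"
proof -
  obtain r' where r: "r = Suc r'"
    using \<open>r > 0\<close> by (cases r) auto
  show ?thesis
    using backward_factor_not_surj[OF assms(1)] hardy_toeplitz_poly
    unfolding r toeplitz_poly_linear_mult by blast
qed

text \<open>The zeros are listed by increasing modulus, so invertibility means that the unit circle
  separates the first \<open>r\<close> of them from the others. If it does not, there are three cases. The \<open>r\<close>-th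
  zero may lie outside the closed disc: then there is a kernel. The next zero may lie in the closed
  disc, or the \<open>r\<close>-th on the circle: then the range is proper.\<close>

theorem bij_toeplitz_poly_imp_separated:
  assumes c: "c \<noteq> 0" and len: "length ws = r + s" and rs: "r > 0" "s > 0"
    and sorted: "sorted (map cmod ws)"
    and bij: "bij_betw (toeplitz_poly r (smult c (root_poly ws))) hardy hardy"
  shows "cmod (ws ! (r - 1)) < 1 \<and> 1 < cmod (ws ! r)"
proof (rule ccontr)
  assume neg: "\<not> ?thesis"
  let ?T = "toeplitz_poly r (smult c (root_poly ws))"
  have mono: "cmod (ws ! i) \<le> cmod (ws ! j)" if "i \<le> j" "j < r + s" for i j
    using sorted_nth_mono[OF sorted that(1)] that len by simp
  have split: "root_poly ws = root_poly (take n ws) * root_poly (drop n ws)" for n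
    by (simp flip: root_poly_append)
  have surj: "\<exists>F\<in>hardy. ?T F = G" if "G \<in> hardy" for G
    by (rule bij_hardy_surj[OF bij that])
  consider "cmod (ws ! (r - 1)) = 1" | "cmod (ws ! (r - 1)) > 1" | "cmod (ws ! r) \<le> 1"
    using neg by linarith
  then show False
  proof cases
    case 1
    have "drop (r - 1) ws = ws ! (r - 1) # drop r ws"
      using rs len Cons_nth_drop_Suc[of "r - 1" ws] by simp
    then have "smult c (root_poly ws)
        = [:- (ws ! (r - 1)), 1:] * smult c (root_poly (take (r - 1) ws) * root_poly (drop r ws))"
      unfolding split[of "r - 1"]
      by (simp add: mult_ac del: mult_pCons_left mult_pCons_right)
    then show False
      using toeplitz_poly_not_surjective_unimodular[OF 1 rs(1)] surj by metis
  next
    case 2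
    have outer: "\<forall>w\<in>set (drop (r - 1) ws). 1 < cmod w"
    proof
      fix w assume "w \<in> set (drop (r - 1) ws)"
      then obtain i where "w = ws ! i" "r - 1 \<le> i" "i < r + s"
        using len rs by (auto simp: in_set_conv_nth intro!: that)
      then show "1 < cmod w"
        using 2 mono[of "r - 1" i] by simp
    qed
    have "degree (smult c (root_poly (take (r - 1) ws))) < r"
      using c rs len by simp
    from toeplitz_poly_not_injective[OF outer this]
    obtain F where "F \<in> hardy" "F \<noteq> 0" "?T F = 0"
      by (auto simp: split[of "r - 1"])
    moreover have "?T 0 = 0"
      by (simp add: toeplitz_poly_def)
    ultimately show False
      using bij hardy_zero by (auto simp: bij_betw_def inj_on_def)
  next
    case 3
    have inner: "\<forall>w\<in>set (take (Suc r) ws). cmod w \<le> 1"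
    proof
      fix w assume "w \<in> set (take (Suc r) ws)"
      then obtain i where "w = ws ! i" "i \<le> r"
        using len by (auto simp: in_set_conv_nth)
      then show "cmod w \<le> 1"
        using 3 mono[of i r] rs by simp
    qed
    have "smult c (root_poly ws) = root_poly (take (Suc r) ws) * smult c (root_poly (drop (Suc r) ws))"
      by (simp add: split[of "Suc r"])
    moreover have "r < length (take (Suc r) ws)"
      using rs len by simp
    ultimately show False
      using toeplitz_poly_not_surjective[OF inner] surj[OF hardy_one] by metis
  qed
qed

theorem separated_imp_hardy_iso_toeplitz_poly:
  assumes c: "c \<noteq> 0" and len: "length ws = r + s" and rs: "r > 0" "s > 0"
    and sorted: "sorted (map cmod ws)"
    and sep: "cmod (ws ! (r - 1)) < 1" "1 < cmod (ws ! r)"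
  shows "hardy_iso (toeplitz_poly r (smult c (root_poly ws)))"
proof -
  have mono: "cmod (ws ! i) \<le> cmod (ws ! j)" if "i \<le> j" "j < r + s" for i j
    using sorted_nth_mono[OF sorted that(1)] that len by simp
  have inner: "\<forall>w\<in>set (take r ws). cmod w < 1"
  proof
    fix w assume "w \<in> set (take r ws)"
    then obtain i where "w = ws ! i" "i < r"
      using len by (auto simp: in_set_conv_nth)
    then show "cmod w < 1"
      using sep(1) mono[of i "r - 1"] rs by fastforce
  qed
  have outer: "\<forall>w\<in>set (drop r ws). 1 < cmod w"
  proof
    fix w assume "w \<in> set (drop r ws)"
    then obtain i where "w = ws ! i" "r \<le> i" "i < r + s"
      using len by (auto simp: in_set_conv_nth)
    then show "1 < cmod w"
      using sep mono[of r i] by simp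
  qed
  have "length (take r ws) = r"
    using len by simp
  then show ?thesis
    using hardy_iso_toeplitz_poly[OF c inner outer] by (simp flip: root_poly_append)
qed

section \<open>Polynomials with a dominant coefficient\<close>

definition dominant_coeff :: "complex poly \<Rightarrow> nat \<Rightarrow> bool" where
  "dominant_coeff P r \<longleftrightarrow> (\<Sum>i\<in>{..degree P} - {r}. cmod (coeff P i)) < cmod (coeff P r)"

text \<open>A coefficient of largest modulus exists because the coefficients tend to zero. At its index the
  dominant coefficient outweighs all other terms of the convolution.\<close>

lemma toeplitz_poly_injective_dominant:
  assumes dom: "dominant_coeff P r" and F: "F \<in> hardy" and zero: "toeplitz_poly r P F = 0"
  shows "F = 0"
proof (rule ccontr)
  assume "F \<noteq> 0"
  then obtain m where m: "fps_nth F m \<noteq> 0"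
    by (auto simp: fps_eq_iff)
  have "\<forall>\<^sub>F n in sequentially. cmod (fps_nth F n) < cmod (fps_nth F m)"
    by (rule order_tendstoD(2)[OF hardy_coeff_tendsto_zero[OF F]]) (use m in simp)
  then obtain N where N: "\<And>n. n \<ge> N \<Longrightarrow> cmod (fps_nth F n) < cmod (fps_nth F m)"
    by (auto simp: eventually_sequentially)
  obtain j where "is_arg_min (\<lambda>n. - cmod (fps_nth F n)) (\<lambda>n. n \<in> {..max N m}) j"
    using ex_is_arg_min_if_finite[of "{..max N m}" "\<lambda>n. - cmod (fps_nth F n)"] by auto
  then have j: "cmod (fps_nth F n) \<le> cmod (fps_nth F j)" if "n \<le> max N m" for n
    using that by (simp add: is_arg_min_linorder)
  have max: "cmod (fps_nth F n) \<le> cmod (fps_nth F j)" for n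
    using j[of n] j[of m] N[of n] by (cases "n \<le> max N m") fastforce+
  have pos: "cmod (fps_nth F j) > 0"
    using j[of m] m by (metis max.cobounded2 norm_le_zero_iff not_le order_trans)
  define f where "f i = coeff P i * fps_nth F (j + r - i)" for i
  have "0 = fps_nth (fps_of_poly P * F) (j + r)"
    using arg_cong[OF zero, of "\<lambda>G. fps_nth G j"] by (simp add: toeplitz_poly_def)
  also have "\<dots> = (\<Sum>i\<le>j + r. f i)"
    by (simp add: fps_mult_nth f_def atLeast0AtMost)
  also have "\<dots> = f r + (\<Sum>i\<in>{..j + r} - {r}. f i)"
    by (rule sum.remove) auto
  finally have "cmod (f r) = cmod (\<Sum>i\<in>{..j + r} - {r}. f i)"
    by (metis add_eq_0_iff norm_minus_cancel)
  also have "\<dots> \<le> (\<Sum>i\<in>{..j + r} - {r}. cmod (coeff P i) * cmod (fps_nth F j))"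
    by (rule sum_norm_le) (simp add: f_def norm_mult mult_left_mono max)
  also have "\<dots> \<le> (\<Sum>i\<in>{..degree P} - {r}. cmod (coeff P i) * cmod (fps_nth F j))"
  proof -
    let ?g = "\<lambda>i. cmod (coeff P i) * cmod (fps_nth F j)"
    have "sum ?g ({..j + r} - {r}) = sum ?g (({..j + r} - {r}) \<inter> {..degree P})"
      by (rule sum.mono_neutral_right) (auto intro: le_degree)
    also have "\<dots> \<le> sum ?g ({..degree P} - {r})"
      by (rule sum_mono2) auto
    finally show ?thesis .
  qed
  also have "\<dots> = (\<Sum>i\<in>{..degree P} - {r}. cmod (coeff P i)) * cmod (fps_nth F j)"
    by (simp add: sum_distrib_right)
  also have "\<dots> < cmod (coeff P r) * cmod (fps_nth F j)"
    using dom pos by (simp add: dominant_coeff_def)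
  finally show False
    by (simp add: f_def norm_mult)
qed

text \<open>The kernel constructed from too many zeros outside the closed disc would contradict injectivity.
  So a polynomial of degree \<open>n\<close> with dominant \<open>r\<close>-th coefficient has at most \<open>n - r\<close> zeros there. This
  is one half of Pellet's theorem.\<close>

lemma dominant_outer_zeros:
  assumes "dominant_coeff (A * root_poly vs) r" and "\<forall>w\<in>set vs. 1 < cmod w"
  shows "r \<le> degree A"
  using assms toeplitz_poly_not_injective[of vs A r] toeplitz_poly_injective_dominant
  by (metis not_le)

lemma reflect_root_poly:
  assumes "0 \<notin> set us"
  shows "\<exists>c\<noteq>0. reflect_poly (root_poly us) = smult c (root_poly (map inverse us))"
  using assms
proof (induction us)
  case (Cons w us)
  then obtain c where c: "c \<noteq> 0"
    and eq: "reflect_poly (root_poly us) = smult c (root_poly (map inverse us))"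
    by auto
  have w: "reflect_poly [:- w, 1:] = smult (- w) [:- inverse w, 1:]"
    using Cons.prems by (simp add: reflect_poly_pCons)
  have "reflect_poly (root_poly (w # us)) = smult (- w * c) (root_poly (map inverse (w # us)))"
    by (simp add: reflect_poly_mult w eq mult_ac del: mult_pCons_left mult_pCons_right smult_pCons)
  then show ?case
    using c Cons.prems by (intro exI[of _ "- w * c"]) auto
qed (auto intro!: exI[of _ 1])

text \<open>The other half of Pellet's theorem follows by reversing the order of the coefficients, which
  inverts the zeros and exchanges the two sides of the unit circle.\<close>

lemma dominant_inner_zeros:
  assumes dom: "dominant_coeff (A * root_poly us) r" and us: "\<forall>w\<in>set us. cmod w < 1"
    and nz: "0 \<notin> set us" "coeff A 0 \<noteq> 0"
  shows "length us \<le> r"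
proof (cases "r \<le> degree (A * root_poly us)")
  case True
  define P where "P = A * root_poly us"
  define n where "n = degree P"
  obtain c where c: "c \<noteq> 0"
    and eq: "reflect_poly (root_poly us) = smult c (root_poly (map inverse us))"
    using reflect_root_poly[OF nz(1)] by blast
  have A: "A \<noteq> 0"
    using nz(2) by auto
  have P0: "coeff P 0 \<noteq> 0"
    using nz(2) coeff_0_root_poly[OF nz(1)] by (simp add: P_def coeff_mult)
  have n: "n = degree A + length us" "degree (reflect_poly P) = n"
    using A P0 by (simp_all add: n_def P_def degree_mult_eq del: mult_eq_0_iff)
  have "(\<Sum>i\<in>{..n} - {n - r}. cmod (coeff (reflect_poly P) i)) = (\<Sum>i\<in>{..n} - {r}. cmod (coeff P i))"
    by (rule sum.reindex_bij_witness[of _ "\<lambda>i. n - i" "\<lambda>i. n - i"])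
       (use True in \<open>auto simp: coeff_reflect_poly n_def P_def\<close>)
  then have "dominant_coeff (reflect_poly P) (n - r)"
    using dom True by (simp add: dominant_coeff_def n(2) coeff_reflect_poly flip: n_def P_def)
  moreover have "reflect_poly P = smult c (reflect_poly A) * root_poly (map inverse us)"
    by (simp add: P_def reflect_poly_mult eq)
  moreover have "\<forall>w\<in>set (map inverse us). 1 < cmod w"
    using us nz(1) by (auto simp: norm_inverse one_less_inverse_iff)
  ultimately have "n - r \<le> degree (smult c (reflect_poly A))"
    using dominant_outer_zeros by metis
  also have "\<dots> = degree A"
    using c nz(2) by simp
  finally show ?thesis
    using n(1) by simp
next
  case False
  then have "coeff (A * root_poly us) r = 0"
    by (simp add: coeff_eq_0)
  then have "(\<Sum>i\<in>{..degree (A * root_poly us)} - {r}. cmod (coeff (A * root_poly us) i)) < 0"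
    using dom by (simp add: dominant_coeff_def)
  then show ?thesis
    by (meson norm_ge_zero not_less sum_nonneg)
qed

lemma dominant_not_root_unimodular:
  assumes dom: "dominant_coeff P r" and w: "cmod w = 1"
  shows "poly P w \<noteq> 0"
proof
  assume "poly P w = 0"
  moreover have "r \<le> degree P"
    using dom by (rule_tac ccontr) (auto simp: dominant_coeff_def coeff_eq_0 not_le sum_nonneg leD)
  ultimately have "0 = coeff P r * w ^ r + (\<Sum>i\<in>{..degree P} - {r}. coeff P i * w ^ i)"
    by (subst (asm) poly_altdef, subst (asm) sum.remove[of _ r]) auto
  then have "cmod (coeff P r * w ^ r) = cmod (\<Sum>i\<in>{..degree P} - {r}. coeff P i * w ^ i)"
    by (metis add_eq_0_iff norm_minus_cancel)
  also have "\<dots> \<le> (\<Sum>i\<in>{..degree P} - {r}. cmod (coeff P i))"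
    by (rule sum_norm_le) (simp add: norm_mult norm_power w)
  finally show False
    using dom by (simp add: dominant_coeff_def norm_mult norm_power w)
qed

theorem dominant_coeff_separates:
  assumes c: "c \<noteq> 0" and len: "length zs = r + s" and rs: "r > 0" "s > 0"
    and sorted: "sorted (map cmod zs)" and nz: "0 \<notin> set zs"
    and dom: "dominant_coeff (smult c (root_poly zs)) r"
  shows "cmod (zs ! (r - 1)) < 1 \<and> 1 < cmod (zs ! r)"
proof (rule ccontr)
  assume neg: "\<not> ?thesis"
  have mono: "cmod (zs ! i) \<le> cmod (zs ! j)" if "i \<le> j" "j < r + s" for i j
    using sorted_nth_mono[OF sorted that(1)] that len by simp
  have split: "root_poly zs = root_poly (take n zs) * root_poly (drop n zs)" for n
    by (simp flip: root_poly_append)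
  have not1: "cmod (zs ! i) \<noteq> 1" if "i < r + s" for i
    using dominant_not_root_unimodular[OF dom] poly_root_poly_eq_0[of "zs ! i" zs] that len by auto
  consider "1 < cmod (zs ! (r - 1))" | "cmod (zs ! r) < 1"
    using neg not1[of r] not1[of "r - 1"] rs by fastforce
  then show False
  proof cases
    case 1
    have outer: "\<forall>w\<in>set (drop (r - 1) zs). 1 < cmod w"
    proof
      fix w assume "w \<in> set (drop (r - 1) zs)"
      then obtain i where "w = zs ! i" "r - 1 \<le> i" "i < r + s"
        using len rs by (auto simp: in_set_conv_nth intro!: that)
      then show "1 < cmod w"
        using 1 mono[of "r - 1" i] by simp
    qed
    have "dominant_coeff (smult c (root_poly (take (r - 1) zs)) * root_poly (drop (r - 1) zs)) r"
      using dom by (simp add: split[of "r - 1"])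
    from dominant_outer_zeros[OF this outer] show False
      using c rs len by simp
  next
    case 2
    have inner: "\<forall>w\<in>set (take (Suc r) zs). cmod w < 1"
    proof
      fix w assume "w \<in> set (take (Suc r) zs)"
      then obtain i where "w = zs ! i" "i \<le> r"
        using len by (auto simp: in_set_conv_nth)
      then show "cmod w < 1"
        using 2 mono[of i r] rs by simp
    qed
    have "dominant_coeff (smult c (root_poly (drop (Suc r) zs)) * root_poly (take (Suc r) zs)) r"
      using dom by (simp add: split[of "Suc r"] mult.commute)
    moreover have "0 \<notin> set (take (Suc r) zs)"
      using nz set_take_subset by fastforce
    moreover have "coeff (root_poly (drop (Suc r) zs)) 0 \<noteq> 0"
      using nz set_drop_subset by (intro coeff_0_root_poly) fastforce
    ultimately have "length (take (Suc r) zs) \<le> r"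
      using dominant_inner_zeros[of "smult c (root_poly (drop (Suc r) zs))" "take (Suc r) zs" r]
        inner c by simp
    then show False
      using len rs by simp
  qed
qed

section \<open>Toeplitz operators of Laurent polynomials\<close>

lemma has_integral_cis_multiple:
  "((\<lambda>v. cis (of_int m * v)) has_integral (if m = 0 then of_real (2 * pi) else 0)) {0..2 * pi}"
proof (cases "m = 0")
  case True
  have "((\<lambda>v. 1 :: complex) has_integral (2 * pi - 0) *\<^sub>R 1) {0..2 * pi}"
    using has_integral_const_real[of "1::complex" 0 "2 * pi"] by simp
  with True show ?thesis
    by (simp add: scaleR_conv_of_real)
next
  case False
  define g where "g v = exp (\<i> * of_int m * of_real v) / (\<i> * of_int m)" for v :: real
  have cis: "exp (\<i> * of_int m * of_real v) = cis (of_int m * v)" for v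
    by (simp add: cis_conv_exp mult.assoc)
  have "((\<lambda>v. cis (of_int m * v)) has_integral (g (2 * pi) - g 0)) {0..2 * pi}"
  proof (rule fundamental_theorem_of_calculus)
    fix v :: real
    show "(g has_vector_derivative cis (of_int m * v)) (at v within {0..2 * pi})"
      unfolding g_def cis[symmetric] using False
      by (intro has_vector_derivative_real_field) (auto intro!: derivative_eq_intros)
  qed simp
  moreover have "g (2 * pi) = g 0"
    using cis_multiple_2pi[of "of_int m"] by (simp add: g_def cis mult.commute mult.left_commute)
  ultimately show ?thesis
    using False by simp
qed

lemma fourier_coeff_dilate_laurent:
  "fourier_coeff (dilate (laurent b r s) \<rho>) k
     = (if k \<in> {- int r..int s} then b k * of_real \<rho> powi k else 0)"
proof -
  have eq: "dilate (laurent b r s) \<rho> (cis v) * cis (- (of_int k * v))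
      = (\<Sum>n = - int r..int s. b n * of_real \<rho> powi n * cis (of_int (n - k) * v))" for v
  proof -
    have "cis v powi n * cis (- (of_int k * v)) = cis (of_int (n - k) * v)" for n
      by (simp add: cis_power_int cis_mult algebra_simps)
    then show ?thesis
      by (simp add: dilate_def laurent_def power_int_mult_distrib sum_distrib_right mult.assoc)
  qed
  have "((\<lambda>v. dilate (laurent b r s) \<rho> (cis v) * cis (- (of_int k * v))) has_integral
      (\<Sum>n = - int r..int s. b n * of_real \<rho> powi n * (if n - k = 0 then of_real (2 * pi) else 0)))
      {0..2 * pi}"
    unfolding eq
    by (intro has_integral_sum has_integral_mult_right has_integral_cis_multiple) auto
  then have "integral {0..2 * pi} (\<lambda>v. dilate (laurent b r s) \<rho> (cis v) * cis (- (of_int k * v)))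
      = (\<Sum>n = - int r..int s. if n = k then b n * of_real \<rho> powi n * of_real (2 * pi) else 0)"
    by (subst integral_unique, assumption) (rule sum.cong, auto)
  then show ?thesis
    by (simp add: fourier_coeff_def sum.delta)
qed

lemma toeplitz_minus_eq_toeplitz_poly:
  assumes coeff: "\<And>i. coeff Q i = fourier_coeff a (int i - int r) - (if i = r then z else 0)"
    and vanish: "\<And>k. k < - int r \<Longrightarrow> fourier_coeff a k = 0"
  shows "(\<lambda>n. toeplitz a x n - z * x n) = fps_nth (toeplitz_poly r Q (Abs_fps x))"
proof
  fix j
  have "toeplitz a x j = (\<Sum>k\<le>j + r. fourier_coeff a (int j - int k) * x k)"
    unfolding toeplitz_def by (rule suminf_finite) (auto simp: vanish)
  moreover have "z * x j = (\<Sum>k\<le>j + r. (if k = j then z else 0) * x k)"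
    by (simp add: if_distrib[of "\<lambda>c. c * _"] sum.delta cong: if_cong)
  ultimately have "toeplitz a x j - z * x j
      = (\<Sum>k\<le>j + r. (fourier_coeff a (int j - int k) - (if k = j then z else 0)) * x k)"
    by (simp add: left_diff_distrib sum_subtractf)
  also have "\<dots> = (\<Sum>k\<le>j + r. coeff Q (j + r - k) * x k)"
    by (rule sum.cong) (auto simp: coeff of_nat_diff)
  also have "\<dots> = fps_nth (Abs_fps x * fps_of_poly Q) (j + r)"
    by (simp add: fps_mult_nth atLeast0AtMost mult.commute)
  finally show "toeplitz a x j - z * x j = fps_nth (toeplitz_poly r Q (Abs_fps x)) j"
    by (simp add: toeplitz_poly_def mult.commute)
qed

lemma not_in_spectrumI:
  assumes eq: "\<And>x. (\<lambda>n. A x n - z * x n) = fps_nth (toeplitz_poly r Q (Abs_fps x))"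
    and iso: "hardy_iso (toeplitz_poly r Q)"
  shows "z \<notin> spectrum_ell2 A"
proof -
  let ?T = "toeplitz_poly r Q"
  obtain K where bij: "bij_betw ?T hardy hardy"
    and K: "\<And>F. F \<in> hardy \<Longrightarrow> hardy_norm F \<le> K * hardy_norm (?T F)"
    using iso by (auto simp: hardy_iso_def)
  define S where "S = inv_into hardy ?T"
  define B where "B x = fps_nth (S (Abs_fps x))" for x
  have inj: "inj_on ?T hardy"
    using bij by (simp add: bij_betw_def)
  have S: "S G \<in> hardy" "?T (S G) = G" if "G \<in> hardy" for G
    using that bij unfolding S_def
    by (auto simp: bij_betw_def inv_into_into f_inv_into_f)
  have S_eq: "S G = F" if "F \<in> hardy" "?T F = G" for F G
    using inv_into_f_f[OF inj that(1)] that(2) by (simp add: S_def)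
  have nth: "fps_nth (Abs_fps x) = x" for x :: "nat \<Rightarrow> complex"
    by (simp add: Abs_fps_inverse)
  have ell2: "Abs_fps x \<in> hardy \<longleftrightarrow> x \<in> ell2" for x
    by (simp add: hardy_def nth)
  have "S (F + G) = S F + S G" if "F \<in> hardy" "G \<in> hardy" for F G
    using that S hardy_add
    by (intro S_eq) (auto simp: toeplitz_poly_def distrib_left fps_shift_add)
  moreover have "S (fps_const c * F) = fps_const c * S F" if "F \<in> hardy" for F c
  proof (rule S_eq)
    have "?T (fps_const c * S F) = fps_const c * ?T (S F)"
      by (simp add: toeplitz_poly_def fps_eq_iff mult.left_commute[of _ "fps_const c"])
    then show "?T (fps_const c * S F) = fps_const c * F"
      using S that by simp
  qed (use S hardy_const_mult that in auto)
  moreover have "Abs_fps (\<lambda>n. x n + y n) = Abs_fps x + Abs_fps y"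
    "Abs_fps (\<lambda>n. c * x n) = fps_const c * Abs_fps x" for x y and c :: complex
    by (simp_all add: fps_eq_iff)
  ultimately have "B (\<lambda>n. x n + y n) = (\<lambda>n. B x n + B y n)" "B (\<lambda>n. c * x n) = (\<lambda>n. c * B x n)"
    if "x \<in> ell2" "y \<in> ell2" for x y c
    using that by (simp_all add: B_def ell2 fun_eq_iff)
  moreover have "B x \<in> ell2" if "x \<in> ell2" for x
    using S(1)[of "Abs_fps x"] that ell2 by (simp add: B_def hardy_def)
  moreover have "ell2_norm (B x) \<le> K * ell2_norm x" if "x \<in> ell2" for x
    using K[OF S(1), of "Abs_fps x"] S(2)[of "Abs_fps x"] that
    by (simp add: B_def hardy_norm_def ell2 nth)
  ultimately have "bounded_op_ell2 B"
    unfolding bounded_op_ell2_def by blast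
  moreover have "B (\<lambda>n. A x n - z * x n) = x" if "x \<in> ell2" for x
  proof -
    have "B (fps_nth (?T (Abs_fps x))) = x"
      using S_eq[of "Abs_fps x"] that by (simp add: B_def ell2 nth fps_nth_inverse)
    then show ?thesis
      unfolding eq[symmetric] .
  qed
  moreover have "(\<lambda>n. A (B x) n - z * B x n) = x" if "x \<in> ell2" for x
  proof -
    have "fps_nth (?T (Abs_fps (B x))) = x"
      using S(2)[of "Abs_fps x"] that by (simp add: B_def ell2 nth fps_nth_inverse)
    then show ?thesis
      unfolding eq[symmetric] .
  qed
  ultimately show ?thesis
    unfolding spectrum_ell2_def by blast
qed

lemma not_in_spectrumD:
  assumes eq: "\<And>x. (\<lambda>n. A x n - z * x n) = fps_nth (toeplitz_poly r Q (Abs_fps x))"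
    and "z \<notin> spectrum_ell2 A"
  shows "bij_betw (toeplitz_poly r Q) hardy hardy"
proof -
  obtain B where B: "bounded_op_ell2 B"
    and BA: "\<And>x. x \<in> ell2 \<Longrightarrow> B (fps_nth (toeplitz_poly r Q (Abs_fps x))) = x"
    and AB: "\<And>x. x \<in> ell2 \<Longrightarrow> fps_nth (toeplitz_poly r Q (Abs_fps (B x))) = x"
    using assms(2) unfolding spectrum_ell2_def eq[symmetric] by blast
  show ?thesis
  proof (rule bij_betw_byWitness[where f' = "\<lambda>F. Abs_fps (B (fps_nth F))"])
    show "\<forall>F\<in>hardy. Abs_fps (B (fps_nth (toeplitz_poly r Q F))) = F"
      using BA by (auto simp: hardy_def fps_nth_inverse)
         (metis fps_nth_inverse)
    show "\<forall>F\<in>hardy. toeplitz_poly r Q (Abs_fps (B (fps_nth F))) = F"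
      using AB by (auto simp: hardy_def fps_nth_inject[symmetric])
    show "toeplitz_poly r Q ` hardy \<subseteq> hardy"
      using hardy_toeplitz_poly by auto
    show "(\<lambda>F. Abs_fps (B (fps_nth F))) ` hardy \<subseteq> hardy"
      using B by (auto simp: hardy_def bounded_op_ell2_def Abs_fps_inverse)
  qed
qed

lemma coeff_char_poly_laurent:
  "coeff (char_poly_laurent b r s z) i
     = (if i \<le> r + s then b (int i - int r) else 0) - (if i = r then z else 0)"
proof -
  have "(\<Sum>n = - int r..int s. coeff (monom (b n) (nat (n + int r))) i)
      = (\<Sum>n = - int r..int s. if n = int i - int r then b n else 0)"
    by (rule sum.cong) (auto simp: coeff_monom)
  also have "\<dots> = (if i \<le> r + s then b (int i - int r) else 0)"
    by (auto simp: sum.delta)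
  finally show ?thesis
    by (simp add: char_poly_laurent_def coeff_sum coeff_monom)
qed

lemma degree_char_poly_laurent:
  assumes "s > 0" and "b (int s) \<noteq> 0"
  shows "degree (char_poly_laurent b r s z) = r + s"
proof (rule antisym)
  show "degree (char_poly_laurent b r s z) \<le> r + s"
    by (rule degree_le) (simp add: coeff_char_poly_laurent)
  show "r + s \<le> degree (char_poly_laurent b r s z)"
    by (rule le_degree) (use assms in \<open>simp add: coeff_char_poly_laurent\<close>)
qed

lemma eq_smult_root_poly:
  assumes "mset zs = proots P"
  shows "P = smult (lead_coeff P) (root_poly zs)"
  using complex_poly_decompose_multiset[of P] unfolding root_poly_def
  by (simp flip: assms prod_mset_prod_list)

lemma pcompose_root_poly:
  assumes "c \<noteq> 0"
  shows "root_poly zs \<circ>\<^sub>p [:0, c:] = smult (c ^ length zs) (root_poly (map (\<lambda>z. z / c) zs))"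
proof (induction zs)
  case (Cons z zs)
  have "[:- z, 1:] \<circ>\<^sub>p [:0, c:] = smult c [:- (z / c), 1:]"
    using assms by (simp add: pcompose_pCons)
  then show ?case
    by (simp add: pcompose_mult Cons.IH mult_ac
        del: mult_pCons_left mult_pCons_right smult_pCons)
qed (simp add: pcompose_1)

text \<open>Dilating the symbol divides its zeros by \<open>\<rho>\<close>, so the unit circle becomes the circle of radius
  \<open>\<rho>\<close> for the original zeros.\<close>

theorem mem_spectrum_dilate_iff:
  assumes rs: "r > 0" "s > 0" and bs: "b (int s) \<noteq> 0" and \<rho>: "\<rho> > 0"
    and zs: "mset zs = proots (char_poly_laurent b r s z)" "sorted (map cmod zs)"
  shows "z \<in> spectrum_ell2 (toeplitz (dilate (laurent b r s) \<rho>))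
    \<longleftrightarrow> \<not> (cmod (zs ! (r - 1)) < \<rho> \<and> \<rho> < cmod (zs ! r))"
proof -
  let ?P = "char_poly_laurent b r s z" and ?a = "dilate (laurent b r s) \<rho>"
  define c where "c = complex_of_real \<rho>"
  define ws where "ws = map (\<lambda>z. z / c) zs"
  define d where "d = inverse c ^ r * lead_coeff ?P * c ^ (r + s)"
  have c: "c \<noteq> 0" "cmod c = \<rho>"
    using \<rho> by (simp_all add: c_def)
  have deg: "degree ?P = r + s"
    using rs(2) bs by (rule degree_char_poly_laurent)
  have len: "length zs = r + s"
    using size_proots_complex[of ?P] deg by (metis size_mset zs(1))
  have P0: "?P \<noteq> 0"
    using deg rs by auto
  have d: "d \<noteq> 0"
    using c P0 by (simp add: d_def)
  have Q: "smult (inverse c ^ r) (?P \<circ>\<^sub>p [:0, c:]) = smult d (root_poly ws)"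
    using arg_cong[OF eq_smult_root_poly[OF zs(1)], of "\<lambda>p. p \<circ>\<^sub>p [:0, c:]"]
      pcompose_root_poly[OF c(1), of zs]
    by (simp add: pcompose_smult len d_def ws_def mult_ac)
  have coeff_Q: "coeff (smult d (root_poly ws)) i
      = fourier_coeff ?a (int i - int r) - (if i = r then z else 0)" for i
  proof -
    have powi: "inverse c ^ r * c ^ i = c powi (int i - int r)"
      using c by (simp add: power_int_diff field_simps)
    have "coeff (smult d (root_poly ws)) i = inverse c ^ r * c ^ i * coeff ?P i"
      unfolding Q[symmetric] by (simp add: coeff_pcompose_linear)
    also have "\<dots> = c powi (int i - int r) * (if i \<le> r + s then b (int i - int r) else 0)
        - (if i = r then z else 0)"
      unfolding coeff_char_poly_laurent powi by (simp add: right_diff_distrib)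
    also have "c powi (int i - int r) * (if i \<le> r + s then b (int i - int r) else 0)
        = fourier_coeff ?a (int i - int r)"
      by (auto simp: fourier_coeff_dilate_laurent c_def)
    finally show ?thesis .
  qed
  have eq: "(\<lambda>n. toeplitz ?a x n - z * x n)
      = fps_nth (toeplitz_poly r (smult d (root_poly ws)) (Abs_fps x))" for x
    by (rule toeplitz_minus_eq_toeplitz_poly[OF coeff_Q]) (simp add: fourier_coeff_dilate_laurent)
  have ws: "length ws = r + s" "sorted (map cmod ws)"
    using zs(2) \<rho> by (auto simp: ws_def len c(2) norm_divide sorted_iff_nth_mono divide_right_mono)
  have nth: "cmod (ws ! i) = cmod (zs ! i) / \<rho>" if "i < r + s" for i
    using that by (simp add: ws_def len norm_divide c(2))
  have sep: "cmod (ws ! (r - 1)) < 1 \<and> 1 < cmod (ws ! r)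
      \<longleftrightarrow> cmod (zs ! (r - 1)) < \<rho> \<and> \<rho> < cmod (zs ! r)"
    using rs \<rho> by (simp add: nth field_simps)
  show ?thesis
    using separated_imp_hardy_iso_toeplitz_poly[OF d ws(1) rs ws(2)]
      bij_toeplitz_poly_imp_separated[OF d ws(1) rs ws(2)]
      not_in_spectrumI[OF eq] not_in_spectrumD[OF eq] sep by blast
qed

text \<open>The moduli in increasing order are determined by the multiset of zeros, so any sorted
  enumeration decides membership.\<close>

lemma mem_limit_set_iff:
  assumes zs: "mset zs = proots (char_poly_laurent b r s z)" "sorted (map cmod zs)"
    and len: "length zs = r + s" and "s > 0"
  shows "z \<in> limit_set b r s \<longleftrightarrow> cmod (zs ! (r - 1)) = cmod (zs ! r)"
proof -
  have "cmod (ys ! i) = cmod (zs ! i)"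
    if "mset ys = proots (char_poly_laurent b r s z)" "sorted (map cmod ys)" "i < r + s" for ys i
  proof -
    have "map cmod ys = map cmod zs"
      using that(1,2) zs by (metis mset_map sorted_list_of_multiset_mset sorted_sort_id)
    moreover have "length ys = r + s"
      using that zs len by (metis size_mset)
    ultimately show ?thesis
      using that(3) len by (metis nth_map)
  qed
  then have "cmod (ys ! (r - 1)) = cmod (zs ! (r - 1)) \<and> cmod (ys ! r) = cmod (zs ! r)"
    if "mset ys = proots (char_poly_laurent b r s z)" "sorted (map cmod ys)" for ys
    using that \<open>s > 0\<close> by simp
  then show ?thesis
    unfolding limit_set_def mem_Collect_eq using zs by metis
qed

section \<open>Radii enclosing the zeros\<close>

lemma sum_laurent_index:
  shows "(\<Sum>n = - int r..int s. f n) = (\<Sum>i\<le>r + s. f (int i - int r))"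
    and "(\<Sum>n\<in>{- int r..<int s}. f n) = (\<Sum>i<r + s. f (int i - int r))"
    and "(\<Sum>n\<in>{- int r<..int s}. f n) = (\<Sum>i\<in>{0<..r + s}. f (int i - int r))"
  by (rule sum.reindex_bij_witness[of _ "\<lambda>i. int i - int r" "\<lambda>n. nat (n + int r)"]; force)+

lemma poly_upper_radius_poly:
  "poly (upper_radius_poly b r s) \<rho> = cmod (b (int s)) * \<rho> ^ (r + s)
     - (\<Sum>i<r + s. cmod (b (int i - int r)) * \<rho> ^ i) - coeff_bound b r s * \<rho> ^ r"
  by (simp add: upper_radius_poly_def poly_sum poly_monom sum_laurent_index)

lemma poly_lower_radius_poly:
  "poly (lower_radius_poly b r s) \<rho> = cmod (b (- int r))
     - (\<Sum>i\<in>{0<..r + s}. cmod (b (int i - int r)) * \<rho> ^ i) - coeff_bound b r s * \<rho> ^ r"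
  by (simp add: lower_radius_poly_def poly_sum poly_monom sum_laurent_index)

context
  fixes b :: "int \<Rightarrow> complex" and r s :: nat
  assumes r: "r > 0" and s: "s > 0" and b_r: "b (- int r) \<noteq> 0" and b_s: "b (int s) \<noteq> 0"
begin

lemma coeff_bound_split:
  "coeff_bound b r s = (\<Sum>i<r + s. cmod (b (int i - int r))) + cmod (b (int s))"
  "coeff_bound b r s = cmod (b (- int r)) + (\<Sum>i\<in>{0<..r + s}. cmod (b (int i - int r)))"
proof -
  show "coeff_bound b r s = (\<Sum>i<r + s. cmod (b (int i - int r))) + cmod (b (int s))"
    by (simp add: coeff_bound_def sum_laurent_index flip: lessThan_Suc_atMost)
  have "{..r + s} = insert 0 {0<..r + s}"
    by auto
  then show "coeff_bound b r s = cmod (b (- int r)) + (\<Sum>i\<in>{0<..r + s}. cmod (b (int i - int r)))"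
    by (simp add: coeff_bound_def sum_laurent_index)
qed

lemma coeff_bound_greater:
  "cmod (b (int s)) < coeff_bound b r s" "cmod (b (- int r)) < coeff_bound b r s"
proof -
  have "cmod (b (- int r)) \<le> (\<Sum>i<r + s. cmod (b (int i - int r)))"
    using member_le_sum[of 0 "{..<r + s}" "\<lambda>i. cmod (b (int i - int r))"] r by simp
  moreover have "0 < cmod (b (- int r))"
    using b_r by simp
  ultimately show "cmod (b (int s)) < coeff_bound b r s"
    using coeff_bound_split(1) by linarith
  have "cmod (b (int s)) \<le> (\<Sum>i\<in>{0<..r + s}. cmod (b (int i - int r)))"
    using member_le_sum[of "r + s" "{0<..r + s}" "\<lambda>i. cmod (b (int i - int r))"] r by simp
  moreover have "0 < cmod (b (int s))"
    using b_s by simp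
  ultimately show "cmod (b (- int r)) < coeff_bound b r s"
    using coeff_bound_split(2) by linarith
qed

lemma coeff_bound_pos: "0 < coeff_bound b r s"
  using coeff_bound_greater(1) by (meson norm_ge_zero order_le_less_trans)

text \<open>On \<open>(0, 1]\<close> the term with the coefficient bound alone outweighs the leading term, and on
  \<open>[1, \<infinity>)\<close> it outweighs the constant term. This puts the zeros of the radius polynomials on opposite
  sides of \<open>1\<close>, the radius that serves for all \<open>z\<close> beyond the coefficient bound.\<close>

lemma upper_radius_poly_neg:
  assumes "0 < \<rho>" and "\<rho> \<le> 1"
  shows "poly (upper_radius_poly b r s) \<rho> < 0"
proof -
  have "cmod (b (int s)) * \<rho> ^ (r + s) \<le> cmod (b (int s)) * \<rho> ^ r"
    using assms by (intro mult_left_mono power_decreasing) auto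
  also have "\<dots> < coeff_bound b r s * \<rho> ^ r"
    using assms coeff_bound_greater(1) by simp
  finally have "cmod (b (int s)) * \<rho> ^ (r + s) < coeff_bound b r s * \<rho> ^ r" .
  moreover have "0 \<le> (\<Sum>i<r + s. cmod (b (int i - int r)) * \<rho> ^ i)"
    using assms by (intro sum_nonneg) auto
  ultimately show ?thesis
    unfolding poly_upper_radius_poly by linarith
qed

lemma lower_radius_poly_neg:
  assumes "1 \<le> \<rho>"
  shows "poly (lower_radius_poly b r s) \<rho> < 0"
proof -
  have "cmod (b (- int r)) < coeff_bound b r s * 1"
    using coeff_bound_greater(2) by simp
  also have "\<dots> \<le> coeff_bound b r s * \<rho> ^ r"
    using assms coeff_bound_pos by (intro mult_left_mono) auto
  finally have "cmod (b (- int r)) < coeff_bound b r s * \<rho> ^ r" .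
  moreover have "0 \<le> (\<Sum>i\<in>{0<..r + s}. cmod (b (int i - int r)) * \<rho> ^ i)"
    using assms by (intro sum_nonneg) auto
  ultimately show ?thesis
    unfolding poly_lower_radius_poly by linarith
qed

lemma ex_upper_radius: "\<exists>\<rho>>0. poly (upper_radius_poly b r s) \<rho> = 0"
proof -
  let ?p = "upper_radius_poly b r s"
  have coeff: "coeff ?p i = (if i = r + s then cmod (b (int s)) else 0)
      - (if i < r + s then cmod (b (int i - int r)) else 0)
      - (if i = r then coeff_bound b r s else 0)" for i
  proof -
    have "(\<Sum>k<r + s. coeff (monom (cmod (b (int k - int r))) k) i)
        = (if i < r + s then cmod (b (int i - int r)) else 0)"
      by (simp add: coeff_monom)
    then show ?thesis
      by (simp add: upper_radius_poly_def coeff_sum coeff_monom sum_laurent_index)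
  qed
  have top: "coeff ?p (r + s) = cmod (b (int s))"
    using s by (simp add: coeff)
  have "degree ?p = r + s"
  proof (rule antisym)
    show "degree ?p \<le> r + s"
      by (rule degree_le) (simp add: coeff)
    show "r + s \<le> degree ?p"
      by (rule le_degree) (use b_s top in simp)
  qed
  then have "lead_coeff ?p > 0"
    using top b_s by simp
  then obtain N where N: "\<And>x. x \<ge> N \<Longrightarrow> poly ?p x > 0"
    using poly_pinfty_gt_lc[of ?p] by (metis order_less_le_trans)
  have "\<exists>x. 1 < x \<and> x < max N 2 \<and> poly ?p x = 0"
    by (rule poly_IVT_pos) (use N upper_radius_poly_neg[of 1] in auto)
  then show ?thesis
    by (metis less_trans zero_less_one)
qed

lemma ex_lower_radius: "\<exists>\<rho>>0. poly (lower_radius_poly b r s) \<rho> = 0"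
proof -
  have "(\<Sum>i\<in>{0<..r + s}. cmod (b (int i - int r)) * 0 ^ i) = 0"
    by (rule sum.neutral) auto
  then have "poly (lower_radius_poly b r s) 0 > 0"
    using r b_r unfolding poly_lower_radius_poly by (simp add: power_0_left)
  then have "\<exists>x. 0 < x \<and> x < 1 \<and> poly (lower_radius_poly b r s) x = 0"
    by (intro poly_IVT_neg) (use lower_radius_poly_neg[of 1] in auto)
  then show ?thesis by blast
qed

lemma poly_char_poly_laurent_sum:
  "poly (char_poly_laurent b r s z) w = (\<Sum>i\<le>r + s. b (int i - int r) * w ^ i) - z * w ^ r"
  by (simp add: char_poly_laurent_def poly_sum poly_monom sum_laurent_index)

text \<open>Above a zero of the upper radius polynomial the leading term outgrows all other terms, because it
  carries the highest power. So it cannot be cancelled in the characteristic polynomial.\<close>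

lemma zeros_le_upper_radius:
  assumes z: "cmod z \<le> coeff_bound b r s" and \<rho>: "\<rho> > 0" "poly (upper_radius_poly b r s) \<rho> = 0"
    and w: "poly (char_poly_laurent b r s z) w = 0"
  shows "cmod w \<le> \<rho>"
proof (rule ccontr)
  assume "\<not> cmod w \<le> \<rho>"
  \<comment> \<open>Multiplying the equation for \<open>\<rho>\<close> by \<open>q\<^bsup>r+s\<^esup>\<close> reproduces the leading term at \<open>w\<close> and
    makes all the other terms at least as large as they are at \<open>w\<close>.\<close>
  define q where "q = cmod w / \<rho>"
  have q: "1 < q" "cmod w = q * \<rho>"
    using \<open>\<not> cmod w \<le> \<rho>\<close> \<rho>(1) by (simp_all add: q_def)
  let ?c = "\<lambda>i. cmod (b (int i - int r))" and ?M = "coeff_bound b r s" and ?N = "r + s"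
  have "b (int s) * w ^ ?N = z * w ^ r - (\<Sum>i<?N. b (int i - int r) * w ^ i)"
    using w by (simp add: poly_char_poly_laurent_sum flip: lessThan_Suc_atMost) (simp add: algebra_simps)
  then have "cmod (b (int s) * w ^ ?N) \<le> cmod (z * w ^ r) + cmod (\<Sum>i<?N. b (int i - int r) * w ^ i)"
    using norm_triangle_ineq4 by simp
  also have "\<dots> \<le> ?M * cmod w ^ r + (\<Sum>i<?N. ?c i * cmod w ^ i)"
    by (intro add_mono sum_norm_le) (simp_all add: norm_mult norm_power z mult_right_mono)
  also have "\<dots> < ?M * \<rho> ^ r * q ^ ?N + (\<Sum>i<?N. ?c i * \<rho> ^ i * q ^ ?N)"
  proof (rule add_less_le_mono)
    have "?M * \<rho> ^ r * q ^ r < ?M * \<rho> ^ r * q ^ ?N"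
      using q s \<rho>(1) coeff_bound_pos by (intro mult_strict_left_mono power_strict_increasing) auto
    then show "?M * cmod w ^ r < ?M * \<rho> ^ r * q ^ ?N"
      by (simp add: q(2) power_mult_distrib mult_ac)
    show "(\<Sum>i<?N. ?c i * cmod w ^ i) \<le> (\<Sum>i<?N. ?c i * \<rho> ^ i * q ^ ?N)"
    proof (rule sum_mono)
      fix i assume "i \<in> {..<?N}"
      then have "?c i * \<rho> ^ i * q ^ i \<le> ?c i * \<rho> ^ i * q ^ ?N"
        using q \<rho>(1) by (intro mult_left_mono power_increasing) auto
      then show "?c i * cmod w ^ i \<le> ?c i * \<rho> ^ i * q ^ ?N"
        by (simp add: q(2) power_mult_distrib mult_ac)
    qed
  qed
  also have "\<dots> = (?M * \<rho> ^ r + (\<Sum>i<?N. ?c i * \<rho> ^ i)) * q ^ ?N"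
    by (simp add: distrib_right sum_distrib_right)
  also have "\<dots> = cmod (b (int s)) * \<rho> ^ ?N * q ^ ?N"
    using \<rho>(2) by (simp add: poly_upper_radius_poly)
  also have "\<dots> = cmod (b (int s) * w ^ ?N)"
    by (simp add: norm_mult norm_power q(2) power_mult_distrib mult_ac)
  finally show False by simp
qed

text \<open>Below a zero of the lower radius polynomial all terms except the constant one have shrunk, so
  they cannot cancel it.\<close>

lemma lower_radius_le_zeros:
  assumes z: "cmod z \<le> coeff_bound b r s" and \<rho>: "\<rho> > 0" "poly (lower_radius_poly b r s) \<rho> = 0"
    and w: "poly (char_poly_laurent b r s z) w = 0"
  shows "\<rho> \<le> cmod w"
proof (rule ccontr)
  assume less: "\<not> \<rho> \<le> cmod w"
  let ?c = "\<lambda>i. cmod (b (int i - int r))" and ?M = "coeff_bound b r s" and ?I = "{0<..r + s}"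
  have "{..r + s} = insert 0 ?I"
    by auto
  then have "b (- int r) = z * w ^ r - (\<Sum>i\<in>?I. b (int i - int r) * w ^ i)"
    using w by (simp add: poly_char_poly_laurent_sum) (simp add: algebra_simps)
  then have "cmod (b (- int r)) \<le> cmod (z * w ^ r) + cmod (\<Sum>i\<in>?I. b (int i - int r) * w ^ i)"
    using norm_triangle_ineq4 by simp
  also have "\<dots> \<le> ?M * cmod w ^ r + (\<Sum>i\<in>?I. ?c i * cmod w ^ i)"
    by (intro add_mono sum_norm_le) (simp_all add: norm_mult norm_power z mult_right_mono)
  also have "\<dots> < ?M * \<rho> ^ r + (\<Sum>i\<in>?I. ?c i * \<rho> ^ i)"
  proof (rule add_less_le_mono)
    show "?M * cmod w ^ r < ?M * \<rho> ^ r"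
      using less r coeff_bound_pos by (intro mult_strict_left_mono power_strict_mono) auto
    show "(\<Sum>i\<in>?I. ?c i * cmod w ^ i) \<le> (\<Sum>i\<in>?I. ?c i * \<rho> ^ i)"
      using less by (intro sum_mono mult_left_mono power_mono) auto
  qed
  also have "\<dots> = cmod (b (- int r))"
    using \<rho>(2) by (simp add: poly_lower_radius_poly)
  finally show False by simp
qed

lemma dominant_char_poly_laurent:
  assumes "coeff_bound b r s < cmod z"
  shows "dominant_coeff (char_poly_laurent b r s z) r"
proof -
  let ?P = "char_poly_laurent b r s z"
  have deg: "degree ?P = r + s"
    using s b_s by (rule degree_char_poly_laurent)
  have "(\<Sum>i\<in>{..degree ?P} - {r}. cmod (coeff ?P i)) = (\<Sum>i\<in>{..r + s} - {r}. cmod (b (int i - int r)))"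
    unfolding deg by (rule sum.cong) (auto simp: coeff_char_poly_laurent)
  also have "\<dots> = coeff_bound b r s - cmod (b 0)"
    by (simp add: coeff_bound_def sum_laurent_index sum_diff1)
  also have "\<dots> < cmod (coeff ?P r)"
    using assms norm_triangle_ineq2[of z "b 0"] norm_minus_commute[of z "b 0"]
    by (simp add: coeff_char_poly_laurent)
  finally show ?thesis
    by (simp add: dominant_coeff_def)
qed

lemma obtain_zeros:
  obtains zs where "mset zs = proots (char_poly_laurent b r s z)" "sorted (map cmod zs)"
    "length zs = r + s"
proof -
  obtain ys where ys: "mset ys = proots (char_poly_laurent b r s z)"
    using ex_mset by blast
  have "length ys = r + s"
    using size_proots_complex[of "char_poly_laurent b r s z"] degree_char_poly_laurent[of s b r z] s b_s
    by (metis size_mset ys)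
  then show thesis
    using ys by (intro that[of "sort_key cmod ys"]) simp_all
qed

text \<open>For \<open>z\<close> beyond the coefficient bound the circle of radius \<open>1\<close> separates the zeros. For other \<open>z\<close>
  all zeros lie in the annulus between the two radii, so any separating circle does too.\<close>

lemma limit_set_eq_Inter_spectra:
  assumes l: "0 < \<rho>\<^sub>l" "poly (lower_radius_poly b r s) \<rho>\<^sub>l = 0"
    and h: "0 < \<rho>\<^sub>h" "poly (upper_radius_poly b r s) \<rho>\<^sub>h = 0"
  defines "spec \<equiv> \<lambda>\<rho>. spectrum_ell2 (toeplitz (dilate (laurent b r s) \<rho>))"
  shows "\<rho>\<^sub>l \<le> \<rho>\<^sub>h" and "limit_set b r s = (\<Inter>\<rho>\<in>{0<..}. spec \<rho>)"
    and "(\<Inter>\<rho>\<in>{0<..}. spec \<rho>) = (\<Inter>\<rho>\<in>{\<rho>\<^sub>l..\<rho>\<^sub>h}. spec \<rho>)"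
proof -
  have one: "\<rho>\<^sub>l < 1" "1 < \<rho>\<^sub>h"
    using lower_radius_poly_neg[of \<rho>\<^sub>l] upper_radius_poly_neg[of \<rho>\<^sub>h] l h by force+
  then show "\<rho>\<^sub>l \<le> \<rho>\<^sub>h" by simp
  have equiv: "(z \<in> limit_set b r s \<longleftrightarrow> z \<in> (\<Inter>\<rho>\<in>{0<..}. spec \<rho>)) \<and>
      (z \<in> (\<Inter>\<rho>\<in>{0<..}. spec \<rho>) \<longleftrightarrow> z \<in> (\<Inter>\<rho>\<in>{\<rho>\<^sub>l..\<rho>\<^sub>h}. spec \<rho>))" for z
  proof -
    let ?P = "char_poly_laurent b r s z"
    obtain zs where zs: "mset zs = proots ?P" "sorted (map cmod zs)" "length zs = r + s"
      by (rule obtain_zeros)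
    define p q where "p = cmod (zs ! (r - 1))" and "q = cmod (zs ! r)"
    have spec: "z \<in> spec \<rho> \<longleftrightarrow> \<not> (p < \<rho> \<and> \<rho> < q)" if "\<rho> > 0" for \<rho>
      unfolding spec_def p_def q_def by (rule mem_spectrum_dilate_iff[OF r s b_s that zs(1,2)])
    have limit: "z \<in> limit_set b r s \<longleftrightarrow> p = q"
      unfolding p_def q_def by (rule mem_limit_set_iff[OF zs s])
    have "p \<le> q"
      using sorted_nth_mono[OF zs(2), of "r - 1" r] zs(3) r s by (simp add: p_def q_def)
    have P0: "?P \<noteq> 0"
      using degree_char_poly_laurent[of s b r z] s b_s by auto
    have root: "poly ?P (zs ! i) = 0" if "i < r + s" for i
    proof -
      have "zs ! i \<in># proots ?P"
        using that zs(3) by (simp flip: zs(1))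
      then show ?thesis
        using P0 by simp
    qed
    have eq_if_narrow: "p = q" if narrow: "\<And>\<rho>. \<rho>\<^sub>l \<le> \<rho> \<Longrightarrow> \<rho> \<le> \<rho>\<^sub>h \<Longrightarrow> \<not> (p < \<rho> \<and> \<rho> < q)"
    proof (cases "cmod z \<le> coeff_bound b r s")
      case True
      have "\<rho>\<^sub>l \<le> p" "q \<le> \<rho>\<^sub>h"
        unfolding p_def q_def
        using lower_radius_le_zeros[OF True l root[of "r - 1"]]
          zeros_le_upper_radius[OF True h root[of r]] r s by auto
      then show ?thesis
        using narrow[of "(p + q) / 2"] \<open>p \<le> q\<close> by (force simp: field_simps)
    next
      case False
      have "?P = smult (lead_coeff ?P) (root_poly zs)"
        by (rule eq_smult_root_poly[OF zs(1)])
      moreover have "dominant_coeff ?P r"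
        using False by (intro dominant_char_poly_laurent) simp
      moreover have "0 \<notin> set zs"
      proof
        assume "0 \<in> set zs"
        then have "0 \<in># proots ?P"
          by (simp flip: zs(1))
        then have "coeff ?P 0 = 0"
          using P0 by (simp add: poly_0_coeff_0)
        then show False
          using b_r r by (simp add: coeff_char_poly_laurent)
      qed
      ultimately have "p < 1 \<and> 1 < q"
        unfolding p_def q_def using P0
        by (intro dominant_coeff_separates[of "lead_coeff ?P" zs r s]) (use zs r s in auto)
      then show ?thesis
        using narrow[of 1] one by simp
    qed
    have all: "z \<in> (\<Inter>\<rho>\<in>{0<..}. spec \<rho>) \<longleftrightarrow> (\<forall>\<rho>>0. \<not> (p < \<rho> \<and> \<rho> < q))"
      using spec by auto
    have some: "z \<in> (\<Inter>\<rho>\<in>{\<rho>\<^sub>l..\<rho>\<^sub>h}. spec \<rho>) \<longleftrightarrow> (\<forall>\<rho>\<in>{\<rho>\<^sub>l..\<rho>\<^sub>h}. \<not> (p < \<rho> \<and> \<rho> < q))"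
      using spec l(1) by auto
    have "p = q" if "\<forall>\<rho>\<in>{\<rho>\<^sub>l..\<rho>\<^sub>h}. \<not> (p < \<rho> \<and> \<rho> < q)"
      using that by (intro eq_if_narrow) simp
    moreover have "\<not> (p < \<rho> \<and> \<rho> < q)" if "p = q" for \<rho>
      using that by simp
    moreover have "\<rho> > 0" if "\<rho> \<in> {\<rho>\<^sub>l..\<rho>\<^sub>h}" for \<rho>
      using that l(1) by simp
    ultimately show ?thesis
      unfolding all some limit by blast
  qed
  show "limit_set b r s = (\<Inter>\<rho>\<in>{0<..}. spec \<rho>)"
    using equiv by blast
  show "(\<Inter>\<rho>\<in>{0<..}. spec \<rho>) = (\<Inter>\<rho>\<in>{\<rho>\<^sub>l..\<rho>\<^sub>h}. spec \<rho>)"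
    using equiv by blast
qed

end

section \<open>The limit set as an intersection of spectra\<close>

theorem proposition2p1:
  fixes b :: "int \<Rightarrow> complex" and r s :: nat
  assumes "r > 0" and "s > 0"
    and "b (- int r) \<noteq> 0" and "b (int s) \<noteq> 0"
  shows "(\<exists>\<rho>\<^sub>l \<rho>\<^sub>h. 0 < \<rho>\<^sub>l \<and> \<rho>\<^sub>l \<le> \<rho>\<^sub>h \<and>
        limit_set b r s =
          (\<Inter>\<rho>\<in>{0<..}. spectrum_ell2 (toeplitz (dilate (laurent b r s) \<rho>))) \<and>
        (\<Inter>\<rho>\<in>{0<..}. spectrum_ell2 (toeplitz (dilate (laurent b r s) \<rho>))) =
          (\<Inter>\<rho>\<in>{\<rho>\<^sub>l..\<rho>\<^sub>h}. spectrum_ell2 (toeplitz (dilate (laurent b r s) \<rho>)))) \<and>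
      (\<exists>\<rho>\<^sub>l>0. poly (lower_radius_poly b r s) \<rho>\<^sub>l = 0) \<and>
      (\<exists>\<rho>\<^sub>h>0. poly (upper_radius_poly b r s) \<rho>\<^sub>h = 0) \<and>
      (\<forall>\<rho>\<^sub>l>0. \<forall>\<rho>\<^sub>h>0.
        poly (lower_radius_poly b r s) \<rho>\<^sub>l = 0 \<longrightarrow>
        poly (upper_radius_poly b r s) \<rho>\<^sub>h = 0 \<longrightarrow>
        \<rho>\<^sub>l \<le> \<rho>\<^sub>h \<and>
        limit_set b r s =
          (\<Inter>\<rho>\<in>{0<..}. spectrum_ell2 (toeplitz (dilate (laurent b r s) \<rho>))) \<and>
        (\<Inter>\<rho>\<in>{0<..}. spectrum_ell2 (toeplitz (dilate (laurent b r s) \<rho>))) =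
          (\<Inter>\<rho>\<in>{\<rho>\<^sub>l..\<rho>\<^sub>h}. spectrum_ell2 (toeplitz (dilate (laurent b r s) \<rho>))))"
proof -
  let ?l = "lower_radius_poly b r s" and ?h = "upper_radius_poly b r s"
  obtain l h where l: "l > 0" "poly ?l l = 0" and h: "h > 0" "poly ?h h = 0"
    using ex_lower_radius[OF assms] ex_upper_radius[OF assms] by blast
  note main = limit_set_eq_Inter_spectra[OF assms]
  show ?thesis
  proof (intro conjI)
    show "\<exists>\<rho>\<^sub>l \<rho>\<^sub>h. 0 < \<rho>\<^sub>l \<and> \<rho>\<^sub>l \<le> \<rho>\<^sub>h \<and>
        limit_set b r s =
          (\<Inter>\<rho>\<in>{0<..}. spectrum_ell2 (toeplitz (dilate (laurent b r s) \<rho>))) \<and>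
        (\<Inter>\<rho>\<in>{0<..}. spectrum_ell2 (toeplitz (dilate (laurent b r s) \<rho>))) =
          (\<Inter>\<rho>\<in>{\<rho>\<^sub>l..\<rho>\<^sub>h}. spectrum_ell2 (toeplitz (dilate (laurent b r s) \<rho>)))"
      by (intro exI[of _ l] exI[of _ h] conjI l(1) main[OF l h])
    show "\<exists>\<rho>\<^sub>l>0. poly ?l \<rho>\<^sub>l = 0" "\<exists>\<rho>\<^sub>h>0. poly ?h \<rho>\<^sub>h = 0"
      using l h by blast+
  next
    show "\<forall>\<rho>\<^sub>l>0. \<forall>\<rho>\<^sub>h>0. poly ?l \<rho>\<^sub>l = 0 \<longrightarrow> poly ?h \<rho>\<^sub>h = 0 \<longrightarrow> \<rho>\<^sub>l \<le> \<rho>\<^sub>h \<and>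
        limit_set b r s =
          (\<Inter>\<rho>\<in>{0<..}. spectrum_ell2 (toeplitz (dilate (laurent b r s) \<rho>))) \<and>
        (\<Inter>\<rho>\<in>{0<..}. spectrum_ell2 (toeplitz (dilate (laurent b r s) \<rho>))) =
          (\<Inter>\<rho>\<in>{\<rho>\<^sub>l..\<rho>\<^sub>h}. spectrum_ell2 (toeplitz (dilate (laurent b r s) \<rho>)))"
      by (intro allI impI conjI) (rule main; assumption)+
  qed
qed

end
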